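(* Let $\mathbb{X}=\{P_1,\dots,P_s\}\subseteq\mathbb{P}^n$ be a set of $s$ distinct $K$-rational points, and let $1\le m\le n+1$. We have $$\mathrm{HP}_{\Omega^m_{R_{\mathbb{X}}/K}}(z)=\begin{cases}\deg(\mathbb{X})&\text{if }m=1,\\0&\text{if }m\ge 2.\end{cases}$$ In particular, the regularity index of $\Omega^m_{R_{\mathbb{X}}/K}$ satisfies $\mathrm{ri}(\Omega^m_{R_{\mathbb{X}}/K})\le 2r_{\mathbb{X}}+m$.
   Context: $K$ is a field of characteristic zero, $S=K[X_0,\dots,X_n]$ ($n\ge 1$) with the standard grading is the homogeneous coordinate ring of $\mathbb{P}^n$ over $K$. $I_{\mathbb{X}}\subseteq S$ is the homogeneous vanishing ideal of the (reduced) set of points $\mathbb{X}$, $R_{\mathbb{X}}=S/I_{\mathbb{X}}$, $x_i$ is the image of $X_i$, and $\deg(\mathbb{X})=s$. Coordinates are chosen so that no point of $\mathbb{X}$ lies on $X_0=0$. $\Omega^1_{R_{\mathbb{X}}/K}$ is the module of Kähler differentials of $R_{\mathbb{X}}/K$, a graded $R_{\mathbb{X}}$-module with $\deg(dx_i)=1$, and $\Omega^m_{R_{\mathbb{X}}/K}=\bigwedge^m_{R_{\mathbb{X}}}\Omega^1_{R_{\mathbb{X}}/K}$. For a finitely generated graded module $M$, $\mathrm{HF}_M(i)=\dim_K M_i$, $\mathrm{HP}_M$ is its Hilbert polynomial, and $\mathrm{ri}(M)=\min\{i\in\mathbb{Z}\mid \mathrm{HF}_M(j)=\mathrm{HP}_M(j)\text{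 for all }j\ge i\}$ (with $\mathrm{ri}(M)=-\infty$ if equality holds for all $j$) is its regularity index; $r_{\mathbb{X}}=\mathrm{ri}(R_{\mathbb{X}})$. *)

theory Defs
  imports
    "HOL-Library.Poly_Mapping"
    "HOL-Library.Extended_Real"
    "HOL-Computational_Algebra.Polynomial"
    "HOL-Algebra.QuotRing"
    "Jordan_Normal_Form.VS_Connect"
begin

section \<open>Modules\<close>

text \<open>The fields \<^const>\<open>monoid.mult\<close> and \<^const>\<open>monoid.one\<close> of a module record carry no meaning.
  A field \<open>K\<close> given as a type \<open>'k\<close> is the record \<^term>\<open>class_ring :: 'k::field ring\<close>.\<close>

definition restrict_scalars ::
    "('k \<Rightarrow> 'r) \<Rightarrow> ('r, 'm, 'z) module_scheme \<Rightarrow> ('k, 'm) module" where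
  "restrict_scalars \<phi> M =
    \<lparr>carrier = carrier M, monoid.mult = (\<lambda>_ _. \<zero>\<^bsub>M\<^esub>), one = \<zero>\<^bsub>M\<^esub>,
     zero = \<zero>\<^bsub>M\<^esub>, add = add M, smult = (\<lambda>c x. \<phi> c \<odot>\<^bsub>M\<^esub> x)\<rparr>"

definition regular_module :: "('r, 'z) ring_scheme \<Rightarrow> ('r, 'r) module" where
  "regular_module R =
    \<lparr>carrier = carrier R, monoid.mult = (\<lambda>_ _. \<zero>\<^bsub>R\<^esub>), one = \<zero>\<^bsub>R\<^esub>,
     zero = \<zero>\<^bsub>R\<^esub>, add = add R, smult = monoid.mult R\<rparr>"

definition quot_module :: "('r, 'm, 'z) module_scheme \<Rightarrow> 'm set \<Rightarrow> ('r, 'm set) module" where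
  "quot_module M N =
    \<lparr>carrier = a_rcosets\<^bsub>M\<^esub> N, monoid.mult = (\<lambda>_ _. N), one = N,
     zero = N, add = set_add M, smult = (\<lambda>r C. \<Union>x\<in>C. N +>\<^bsub>M\<^esub> (r \<odot>\<^bsub>M\<^esub> x))\<rparr>"

definition free_module :: "('r, 'z) ring_scheme \<Rightarrow> 'b set \<Rightarrow> ('r, 'b \<Rightarrow> 'r) module" where
  "free_module R B =
    \<lparr>carrier = {f. (\<forall>b\<in>B. f b \<in> carrier R) \<and> (\<forall>b. b \<notin> B \<longrightarrow> f b = \<zero>\<^bsub>R\<^esub>) \<and>
                   finite {b. f b \<noteq> \<zero>\<^bsub>R\<^esub>}},
     monoid.mult = (\<lambda>_ _ _. \<zero>\<^bsub>R\<^esub>), one = (\<lambda>_. \<zero>\<^bsub>R\<^esub>),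
     zero = (\<lambda>_. \<zero>\<^bsub>R\<^esub>), add = (\<lambda>f g b. f b \<oplus>\<^bsub>R\<^esub> g b), smult = (\<lambda>r f b. r \<otimes>\<^bsub>R\<^esub> f b)\<rparr>"

definition free_gen :: "('r, 'z) ring_scheme \<Rightarrow> 'b \<Rightarrow> 'b \<Rightarrow> 'r" where
  "free_gen R b = (\<lambda>b'. if b' = b then \<one>\<^bsub>R\<^esub> else \<zero>\<^bsub>R\<^esub>)"


section \<open>Kaehler differentials\<close>

text \<open>\<open>\<Omega>\<^sup>1\<close> of an algebra \<open>\<phi> : K \<rightarrow> R\<close> is the free \<open>R\<close>-module on symbols \<open>dx\<close>, \<open>x \<in> R\<close>,
  modulo additivity, the Leibniz rule and \<open>d(\<phi> c) = 0\<close> for \<open>c \<in> K\<close>.\<close>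

definition kaehler_relations ::
    "('r, 'z) ring_scheme \<Rightarrow> ('k \<Rightarrow> 'r) \<Rightarrow> ('r \<Rightarrow> 'r) set" where
  "kaehler_relations R \<phi> =
    (let F = free_module R (carrier R); \<delta> = free_gen R in
      {\<delta> (x \<oplus>\<^bsub>R\<^esub> y) \<ominus>\<^bsub>F\<^esub> (\<delta> x \<oplus>\<^bsub>F\<^esub> \<delta> y) | x y. x \<in> carrier R \<and> y \<in> carrier R} \<union>
      {\<delta> (x \<otimes>\<^bsub>R\<^esub> y) \<ominus>\<^bsub>F\<^esub> (x \<odot>\<^bsub>F\<^esub> \<delta> y \<oplus>\<^bsub>F\<^esub> y \<odot>\<^bsub>F\<^esub> \<delta> x) | x y.
          x \<in> carrier R \<and> y \<in> carrier R} \<union>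
      {\<delta> (\<phi> c) | c. True})"

definition kaehler_submodule ::
    "('r, 'z) ring_scheme \<Rightarrow> ('k \<Rightarrow> 'r) \<Rightarrow> ('r \<Rightarrow> 'r) set" where
  "kaehler_submodule R \<phi> =
    LinearCombinations.module.span R (free_module R (carrier R)) (kaehler_relations R \<phi>)"

definition kaehler ::
    "('r, 'z) ring_scheme \<Rightarrow> ('k \<Rightarrow> 'r) \<Rightarrow> ('r, ('r \<Rightarrow> 'r) set) module" where
  "kaehler R \<phi> = quot_module (free_module R (carrier R)) (kaehler_submodule R \<phi>)"

definition kaehler_d ::
    "('r, 'z) ring_scheme \<Rightarrow> ('k \<Rightarrow> 'r) \<Rightarrow> 'r \<Rightarrow> ('r \<Rightarrow> 'r) set" where
  "kaehler_d R \<phi> x = kaehler_submodule R \<phi> +>\<^bsub>free_module R (carrier R)\<^esub> free_gen R x"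


section \<open>Exterior powers\<close>

text \<open>The \<open>m\<close>-th exterior power of \<open>M\<close> is the free module on \<open>m\<close>-tuples of elements of \<open>M\<close>
  modulo multilinearity and the vanishing of tuples with two equal entries.\<close>

definition tuples :: "('r, 'm, 'z) module_scheme \<Rightarrow> nat \<Rightarrow> 'm list set" where
  "tuples M m = {xs. length xs = m \<and> set xs \<subseteq> carrier M}"

definition ext_relations ::
    "('r, 'y) ring_scheme \<Rightarrow> ('r, 'm, 'z) module_scheme \<Rightarrow> nat \<Rightarrow> ('m list \<Rightarrow> 'r) set" where
  "ext_relations R M m =
    (let F = free_module R (tuples M m); e = free_gen R in
      {e (xs[i := x \<oplus>\<^bsub>M\<^esub> y]) \<ominus>\<^bsub>F\<^esub> (e (xs[i := x]) \<oplus>\<^bsub>F\<^esub> e (xs[i := y])) | xs i x y.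
          xs \<in> tuples M m \<and> i < m \<and> x \<in> carrier M \<and> y \<in> carrier M} \<union>
      {e (xs[i := r \<odot>\<^bsub>M\<^esub> x]) \<ominus>\<^bsub>F\<^esub> r \<odot>\<^bsub>F\<^esub> e (xs[i := x]) | xs i r x.
          xs \<in> tuples M m \<and> i < m \<and> r \<in> carrier R \<and> x \<in> carrier M} \<union>
      {e xs | xs. xs \<in> tuples M m \<and> (\<exists>i j. i < j \<and> j < m \<and> xs ! i = xs ! j)})"

definition ext_submodule ::
    "('r, 'y) ring_scheme \<Rightarrow> ('r, 'm, 'z) module_scheme \<Rightarrow> nat \<Rightarrow> ('m list \<Rightarrow> 'r) set" where
  "ext_submodule R M m =
    LinearCombinations.module.span R (free_module R (tuples M m)) (ext_relations R M m)"

definition ext_power ::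
    "('r, 'y) ring_scheme \<Rightarrow> ('r, 'm, 'z) module_scheme \<Rightarrow> nat \<Rightarrow>
      ('r, ('m list \<Rightarrow> 'r) set) module" where
  "ext_power R M m = quot_module (free_module R (tuples M m)) (ext_submodule R M m)"

definition wedge ::
    "('r, 'y) ring_scheme \<Rightarrow> ('r, 'm, 'z) module_scheme \<Rightarrow> 'm list \<Rightarrow> ('m list \<Rightarrow> 'r) set" where
  "wedge R M xs =
    ext_submodule R M (length xs) +>\<^bsub>free_module R (tuples M (length xs))\<^esub> free_gen R xs"


section \<open>Graded pieces of differential forms\<close>

text \<open>A grading is the family \<open>gr :: int \<Rightarrow> _ set\<close> of its homogeneous components. For a graded
  \<open>K\<close>-algebra \<open>R\<close>, the form \<open>a dx\<close> with \<open>a\<close>, \<open>x\<close> homogeneous has degree \<open>deg a + deg x\<close>, so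
  that \<open>d\<close> has degree \<open>0\<close>; degrees add up in wedge products.\<close>

definition kaehler_grading ::
    "('r, 'z) ring_scheme \<Rightarrow> ('k::field \<Rightarrow> 'r) \<Rightarrow> (int \<Rightarrow> 'r set) \<Rightarrow> int \<Rightarrow> ('r \<Rightarrow> 'r) set set" where
  "kaehler_grading R \<phi> gr i =
    LinearCombinations.module.span class_ring (restrict_scalars \<phi> (kaehler R \<phi>))
      {a \<odot>\<^bsub>kaehler R \<phi>\<^esub> kaehler_d R \<phi> x | a x j k. a \<in> gr j \<and> x \<in> gr k \<and> j + k = i}"

definition ext_grading ::
    "('r, 'y) ring_scheme \<Rightarrow> ('k::field \<Rightarrow> 'r) \<Rightarrow> ('r, 'm, 'z) module_scheme \<Rightarrow>
      (int \<Rightarrow> 'm set) \<Rightarrow> nat \<Rightarrow> int \<Rightarrow> ('m list \<Rightarrow> 'r) set set" where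
  "ext_grading R \<phi> M gr m i =
    LinearCombinations.module.span class_ring (restrict_scalars \<phi> (ext_power R M m))
      {wedge R M ws | ws ds. length ws = m \<and> length ds = m \<and>
          (\<forall>l<m. ws ! l \<in> gr (ds ! l)) \<and> sum_list ds = i}"


section \<open>Hilbert functions\<close>

text \<open>All graded pieces are meant to be finite-dimensional: \<^const>\<open>vectorspace.dim\<close> is unspecified
  otherwise.\<close>

definition hilbert_fun :: "('k::field, 'm) module \<Rightarrow> (int \<Rightarrow> 'm set) \<Rightarrow> int \<Rightarrow> nat" where
  "hilbert_fun V gr i = vectorspace.dim class_ring (V\<lparr>carrier := gr i\<rparr>)"

definition hilbert_poly :: "('k::field, 'm) module \<Rightarrow> (int \<Rightarrow> 'm set) \<Rightarrow> rat poly" where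
  "hilbert_poly V gr =
    (THE p. \<exists>i0. \<forall>i\<ge>i0. of_nat (hilbert_fun V gr i) = poly p (of_int i))"

text \<open>The set below is upwards closed in \<open>\<int>\<close>, so its infimum in the extended reals is its
  minimum, or \<open>-\<infinity>\<close> if it is all of \<open>\<int>\<close>.\<close>

definition reg_index :: "('k::field, 'm) module \<Rightarrow> (int \<Rightarrow> 'm set) \<Rightarrow> ereal" where
  "reg_index V gr =
    (INF i \<in> {i. \<forall>j\<ge>i. of_nat (hilbert_fun V gr j) = poly (hilbert_poly V gr) (of_int j)}.
      ereal (real_of_int i))"


section \<open>Projective space and the homogeneous coordinate ring\<close>

type_synonym 'k mpoly = "(nat \<Rightarrow>\<^sub>0 nat) \<Rightarrow>\<^sub>0 'k"

text \<open>\<open>S = K[X\<^sub>0, \<dots>, X\<^sub>n]\<close>, as a subring of the polynomials in countably many variables.\<close>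

definition poly_ring :: "nat \<Rightarrow> 'k::field mpoly ring" where
  "poly_ring n = class_ring\<lparr>carrier := {f. \<forall>\<alpha>\<in>Poly_Mapping.keys f. Poly_Mapping.keys \<alpha> \<subseteq> {..n}}\<rparr>"

definition mpoly_eval :: "(nat \<Rightarrow> 'k::field) \<Rightarrow> 'k mpoly \<Rightarrow> 'k" where
  "mpoly_eval v f = (\<Sum>\<alpha>\<in>Poly_Mapping.keys f. Poly_Mapping.lookup f \<alpha> *
     (\<Prod>i\<in>Poly_Mapping.keys \<alpha>. v i ^ Poly_Mapping.lookup \<alpha> i))"

text \<open>The degree \<open>d\<close> component of \<open>S\<close>; it is zero for \<open>d < 0\<close>.\<close>

definition poly_grading :: "nat \<Rightarrow> int \<Rightarrow> 'k::field mpoly set" where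
  "poly_grading n d = {f \<in> carrier (poly_ring n). \<forall>\<alpha>\<in>Poly_Mapping.keys f.
     int (\<Sum>i\<in>Poly_Mapping.keys \<alpha>. Poly_Mapping.lookup \<alpha> i) = d}"

text \<open>A point of \<open>\<P>\<^sup>n\<close> is the set of all its coordinate vectors; a vector in \<open>K\<^sup>n\<^sup>+\<^sup>1\<close> is a
  function that vanishes beyond \<open>n\<close>.\<close>

definition proj_space :: "nat \<Rightarrow> (nat \<Rightarrow> 'k::field) set set" where
  "proj_space n = {v. (\<forall>i>n. v i = 0) \<and> (\<exists>i. v i \<noteq> 0)} //
     {(v, w). \<exists>c. c \<noteq> 0 \<and> w = (\<lambda>i. c * v i)}"

definition vanishing_ideal :: "nat \<Rightarrow> (nat \<Rightarrow> 'k::field) set set \<Rightarrow> 'k mpoly set" where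
  "vanishing_ideal n X =
    Idl\<^bsub>poly_ring n\<^esub> {f. (\<exists>d. f \<in> poly_grading n d) \<and> (\<forall>P\<in>X. \<forall>v\<in>P. mpoly_eval v f = 0)}"

definition coord_ring :: "nat \<Rightarrow> (nat \<Rightarrow> 'k::field) set set \<Rightarrow> 'k mpoly set ring" where
  "coord_ring n X = poly_ring n Quot vanishing_ideal n X"

definition coord_class :: "nat \<Rightarrow> (nat \<Rightarrow> 'k::field) set set \<Rightarrow> 'k mpoly \<Rightarrow> 'k mpoly set" where
  "coord_class n X f = vanishing_ideal n X +>\<^bsub>poly_ring n\<^esub> f"

definition coord_const :: "nat \<Rightarrow> (nat \<Rightarrow> 'k::field) set set \<Rightarrow> 'k \<Rightarrow> 'k mpoly set" where
  "coord_const n X c = coord_class n X (Poly_Mapping.single 0 c)"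

definition coord_grading :: "nat \<Rightarrow> (nat \<Rightarrow> 'k::field) set set \<Rightarrow> int \<Rightarrow> 'k mpoly set set" where
  "coord_grading n X d = coord_class n X ` poly_grading n d"

definition coord_vs :: "nat \<Rightarrow> (nat \<Rightarrow> 'k::field) set set \<Rightarrow> ('k, 'k mpoly set) module" where
  "coord_vs n X = restrict_scalars (coord_const n X) (regular_module (coord_ring n X))"

definition diff_forms :: "nat \<Rightarrow> (nat \<Rightarrow> 'k::field) set set \<Rightarrow> nat \<Rightarrow>
    ('k mpoly set, (('k mpoly set \<Rightarrow> 'k mpoly set) set list \<Rightarrow> 'k mpoly set) set) module" where
  "diff_forms n X m =
    ext_power (coord_ring n X) (kaehler (coord_ring n X) (coord_const n X)) m"

definition diff_forms_grading :: "nat \<Rightarrow> (nat \<Rightarrow> 'k::field) set set \<Rightarrow> nat \<Rightarrow> int \<Rightarrow>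
    (('k mpoly set \<Rightarrow> 'k mpoly set) set list \<Rightarrow> 'k mpoly set) set set" where
  "diff_forms_grading n X m =
    ext_grading (coord_ring n X) (coord_const n X) (kaehler (coord_ring n X) (coord_const n X))
      (kaehler_grading (coord_ring n X) (coord_const n X) (coord_grading n X)) m"

definition diff_forms_vs :: "nat \<Rightarrow> (nat \<Rightarrow> 'k::field) set set \<Rightarrow> nat \<Rightarrow>
    ('k, (('k mpoly set \<Rightarrow> 'k mpoly set) set list \<Rightarrow> 'k mpoly set) set) module" where
  "diff_forms_vs n X m = restrict_scalars (coord_const n X) (diff_forms n X m)"

end

theory Submission
  imports Defs
begin

text \<open>Let \<open>f\<^sub>j\<close> be separators of the points \<open>P\<^sub>j = (1 : p\<^sub>j\<^sub>1 : \<dots> : p\<^sub>j\<^sub>n)\<close>, of a common degree \<open>r\<close>; they exist as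
  soon as \<open>HF(r) = s\<close>. Elements of a graded piece are determined by their values at the points, so
  \<open>x\<^sub>k f\<^sub>j = p\<^sub>j\<^sub>k x\<^sub>0 f\<^sub>j\<close>, and the \<open>x\<^sub>0\<^sup>e f\<^sub>j\<^sup>2\<close> span the ring in degree \<open>2r + e\<close>. Differentiating the first
  relation and multiplying by \<open>f\<^sub>j\<close> gives \<open>f\<^sub>j\<^sup>2 dx\<^sub>k = p\<^sub>j\<^sub>k f\<^sub>j\<^sup>2 dx\<^sub>0\<close>. Hence in degrees \<open>\<ge> 2r + 1\<close> the module
  \<open>\<Omega>\<^sup>1\<close> is spanned by the \<open>s\<close> elements \<open>x\<^sub>0\<^sup>e f\<^sub>j\<^sup>2 dx\<^sub>0\<close>, which are independent because the Euler derivation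
  followed by evaluation at \<open>P\<^sub>j\<close> is a derivation dual to them. For \<open>m \<ge> 2\<close> and degrees \<open>\<ge> 2r + m\<close> every
  wedge product reduces to multiples of \<open>dx\<^sub>0 \<and> dx\<^sub>0 \<and> \<dots> = 0\<close>.\<close>

section \<open>Modules\<close>

text \<open>The modules are given by generators and relations, so spanning sets come cheaply, but
  independence, and even the nonvanishing of an element, is visible only through maps out of the
  presentation. Each such map goes to \<open>K\<close>, on which the ring acts through evaluation at
  one point; a family of them dual to the spanning elements yields the dimension. The same duality,
  applied to the evaluations on a graded piece of the coordinate ring, turns the value
  \<open>s\<close> of the Hilbert function into separators. The Euler derivation is chosen because
  it multiplies a form of degree \<open>i\<close> by \<open>i\<close>: it keeps the homogeneous
  generators of the ideal vanishing at the points, hence descends to the quotient, and it fixes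
  \<open>X_0\<close>, whose value at a normalised representative is 1. In the bound,
  \<open>2r\<close> is the degree of a squared separator and \<open>m\<close> that of
  \<open>m\<close> differentials of variables. The argument works for every degree \<open>r\<close>
  with separators; the regularity index enters only as the infimum of such degrees.\<close>

lemma submodule_abelian_subgroup:
  assumes "submodule R N M"
  shows "abelian_subgroup N M"
proof -
  interpret N: submodule R N M by (rule assms)
  interpret module R M by (rule N.module)
  have "\<ominus>\<^bsub>M\<^esub> x \<in> N" if "x \<in> N" for x
    using N.smult_closed[of "\<ominus>\<^bsub>R\<^esub> \<one>\<^bsub>R\<^esub>" x] smult_minus_1[of x] that N.subset
    by (metis R.add.inv_closed R.one_closed subsetD)
  then have "subgroup N (add_monoid M)"
    using N.subset N.zero_closed N.m_closed
    by (intro add.subgroupI) (simp_all only: a_inv_def[symmetric], blast+)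
  then show ?thesis
    by (intro abelian_subgroupI3 additive_subgroup.intro M.abelian_group_axioms)
qed

lemma free_module_nth_closed:
  assumes "cring R" "f \<in> carrier (free_module R B)"
  shows "f b \<in> carrier R"
proof -
  interpret cring R by (rule assms)
  show ?thesis using assms(2) by (cases "b \<in> B") (simp_all add: free_module_def)
qed

lemma free_module_module:
  assumes "cring R"
  shows "module R (free_module R B)"
proof -
  interpret cring R by (rule assms)
  let ?F = "free_module R B"
  have sum: "(\<lambda>b. f b \<oplus>\<^bsub>R\<^esub> g b) \<in> carrier ?F" if "f \<in> carrier ?F" "g \<in> carrier ?F" for f g
  proof -
    have "{b. f b \<oplus>\<^bsub>R\<^esub> g b \<noteq> \<zero>\<^bsub>R\<^esub>} \<subseteq> {b. f b \<noteq> \<zero>\<^bsub>R\<^esub>} \<union> {b. g b \<noteq> \<zero>\<^bsub>R\<^esub>}" by auto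
    with that show ?thesis
      unfolding free_module_def by (auto intro: finite_subset)
  qed
  have smult: "(\<lambda>b. r \<otimes>\<^bsub>R\<^esub> f b) \<in> carrier ?F" if "r \<in> carrier R" "f \<in> carrier ?F" for r f
  proof -
    have "{b. r \<otimes>\<^bsub>R\<^esub> f b \<noteq> \<zero>\<^bsub>R\<^esub>} \<subseteq> {b. f b \<noteq> \<zero>\<^bsub>R\<^esub>}" using that by auto
    with that show ?thesis
      unfolding free_module_def by (auto intro: finite_subset)
  qed
  have zero: "(\<lambda>b. \<zero>\<^bsub>R\<^esub>) \<in> carrier ?F" by (auto simp: free_module_def)
  have ops: "\<zero>\<^bsub>?F\<^esub> = (\<lambda>b. \<zero>\<^bsub>R\<^esub>)" "add ?F = (\<lambda>f g b. f b \<oplus>\<^bsub>R\<^esub> g b)"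
    "smult ?F = (\<lambda>r f b. r \<otimes>\<^bsub>R\<^esub> f b)"
    by (simp_all add: free_module_def)
  note cl = free_module_nth_closed[OF assms, where B = B]
  show ?thesis
  proof (rule module_criteria[OF assms]; unfold ops)
    show "\<forall>v\<in>carrier ?F. \<exists>w\<in>carrier ?F. (\<lambda>b. v b \<oplus>\<^bsub>R\<^esub> w b) = (\<lambda>b. \<zero>\<^bsub>R\<^esub>)"
    proof
      fix v assume v: "v \<in> carrier ?F"
      show "\<exists>w\<in>carrier ?F. (\<lambda>b. v b \<oplus>\<^bsub>R\<^esub> w b) = (\<lambda>b. \<zero>\<^bsub>R\<^esub>)"
        using smult[OF _ v, of "\<ominus>\<^bsub>R\<^esub> \<one>\<^bsub>R\<^esub>"] cl[OF v] 
        by (intro bexI[of _ "\<lambda>b. (\<ominus>\<^bsub>R\<^esub> \<one>\<^bsub>R\<^esub>) \<otimes>\<^bsub>R\<^esub> v b"]) (auto simp: l_minus r_neg)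
    qed
    show "\<forall>v w. v \<in> carrier ?F \<and> w \<in> carrier ?F \<longrightarrow> (\<lambda>b. v b \<oplus>\<^bsub>R\<^esub> w b) = (\<lambda>b. w b \<oplus>\<^bsub>R\<^esub> v b)"
      using cl by (auto intro: a_comm)
  qed (simp_all add: zero sum smult cl a_assoc m_assoc l_distr r_distr fun_eq_iff)
qed

lemma free_module_ops:
  "\<zero>\<^bsub>free_module R B\<^esub> = (\<lambda>b. \<zero>\<^bsub>R\<^esub>)"
  "f \<oplus>\<^bsub>free_module R B\<^esub> g = (\<lambda>b. f b \<oplus>\<^bsub>R\<^esub> g b)"
  "r \<odot>\<^bsub>free_module R B\<^esub> f = (\<lambda>b. r \<otimes>\<^bsub>R\<^esub> f b)"
  by (simp_all add: free_module_def)

lemma free_gen_closed: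
  assumes "cring R" "b \<in> B"
  shows "free_gen R b \<in> carrier (free_module R B)"
proof -
  interpret cring R by (rule assms)
  have "{b'. free_gen R b b' \<noteq> \<zero>\<^bsub>R\<^esub>} \<subseteq> {b}" by (auto simp: free_gen_def)
  then show ?thesis
    using assms(2) by (auto simp: free_module_def free_gen_def intro: finite_subset)
qed

section \<open>Quotient modules, computed on representatives\<close>

locale module_quotient = module R M for R (structure) and M (structure) +
  fixes N
  assumes submodule: "submodule R N M"
begin

abbreviation Q where "Q \<equiv> quot_module M N"
abbreviation cls where "cls x \<equiv> N +>\<^bsub>M\<^esub> x"

interpretation N: submodule R N M by (rule submodule)
interpretation A: abelian_subgroup N M by (rule submodule_abelian_subgroup[OF submodule])

lemma cls_closed: "x \<in> carrier M \<Longrightarrow> cls x \<in> carrier Q"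
  by (auto simp: quot_module_def A_RCOSETS_def')

lemma Q_cases:
  assumes "C \<in> carrier Q"
  obtains x where "x \<in> carrier M" "C = cls x"
  using assms by (auto simp: quot_module_def A_RCOSETS_def')

lemma cls_add: "x \<in> carrier M \<Longrightarrow> y \<in> carrier M \<Longrightarrow> cls x \<oplus>\<^bsub>Q\<^esub> cls y = cls (x \<oplus>\<^bsub>M\<^esub> y)"
  by (simp add: quot_module_def A.a_rcos_sum)

lemma cls_eq_iff:
  assumes "x \<in> carrier M" "y \<in> carrier M"
  shows "cls x = cls y \<longleftrightarrow> x \<ominus>\<^bsub>M\<^esub> y \<in> N"
proof
  assume "cls x = cls y"
  then have "x \<in> cls y" using A.a_rcos_self assms by blast
  then show "x \<ominus>\<^bsub>M\<^esub> y \<in> N" using A.a_rcos_module[OF assms(2,1)] by (simp add: a_minus_def)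
next
  assume "x \<ominus>\<^bsub>M\<^esub> y \<in> N"
  then have "x \<in> cls y" using A.a_rcos_module[OF assms(2,1)] by (simp add: a_minus_def)
  then show "cls x = cls y" using A.a_repr_independence' assms by simp
qed

lemma cls_eq_zero_iff:
  assumes "x \<in> carrier M"
  shows "cls x = \<zero>\<^bsub>Q\<^esub> \<longleftrightarrow> x \<in> N"
proof -
  have "\<zero>\<^bsub>Q\<^esub> = cls \<zero>\<^bsub>M\<^esub>"
    using N.subset by (auto simp: quot_module_def a_r_coset_def')
  then show ?thesis using cls_eq_iff[OF assms, of "\<zero>\<^bsub>M\<^esub>"] assms
    by (simp add: a_minus_def M.minus_equality[of "\<zero>\<^bsub>M\<^esub>" "\<zero>\<^bsub>M\<^esub>"])
qed

lemma cls_zero: "\<zero>\<^bsub>Q\<^esub> = cls \<zero>\<^bsub>M\<^esub>"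
  by (rule sym) (simp add: cls_eq_zero_iff)

text \<open>The scalar action on a coset is a union over all its representatives. Two of them differ
  by an element of \<open>N\<close>, hence so do their multiples by \<open>r\<close>, and all sets
  in the union are the same coset.\<close>

lemma cls_smult:
  assumes "r \<in> carrier R" "x \<in> carrier M"
  shows "r \<odot>\<^bsub>Q\<^esub> cls x = cls (r \<odot>\<^bsub>M\<^esub> x)"
proof -
  have "cls (r \<odot>\<^bsub>M\<^esub> y) = cls (r \<odot>\<^bsub>M\<^esub> x)" if "y \<in> cls x" for y
  proof -
    have y: "y \<in> carrier M" using that assms N.subset by (auto simp: a_r_coset_def')
    have "y \<ominus>\<^bsub>M\<^esub> x \<in> N" using that A.a_rcos_module[OF assms(2) y] by (simp add: a_minus_def)
    then have "r \<odot>\<^bsub>M\<^esub> (y \<ominus>\<^bsub>M\<^esub> x) \<in> N" using assms by auto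
    moreover have "r \<odot>\<^bsub>M\<^esub> (y \<ominus>\<^bsub>M\<^esub> x) = r \<odot>\<^bsub>M\<^esub> y \<ominus>\<^bsub>M\<^esub> r \<odot>\<^bsub>M\<^esub> x"
      using assms y by (simp add: a_minus_def smult_r_distr smult_r_minus)
    ultimately show ?thesis using assms y cls_eq_iff by simp
  qed
  moreover have "x \<in> cls x" using A.a_rcos_self assms by blast
  ultimately have "(\<Union>y\<in>cls x. cls (r \<odot>\<^bsub>M\<^esub> y)) = cls (r \<odot>\<^bsub>M\<^esub> x)" by blast
  then show ?thesis by (simp add: quot_module_def)
qed

lemma Q_module: "module R Q"
proof (rule module_criteria[OF R.is_cring])
  show "\<zero>\<^bsub>Q\<^esub> \<in> carrier Q" by (simp add: cls_zero cls_closed)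
  show "\<forall>v w. v \<in> carrier Q \<and> w \<in> carrier Q \<longrightarrow> v \<oplus>\<^bsub>Q\<^esub> w \<in> carrier Q"
    by (auto elim!: Q_cases simp: cls_add cls_closed)
  show "\<forall>v\<in>carrier Q. \<exists>w\<in>carrier Q. v \<oplus>\<^bsub>Q\<^esub> w = \<zero>\<^bsub>Q\<^esub>"
  proof
    fix v assume "v \<in> carrier Q"
    then obtain x where "x \<in> carrier M" "v = cls x" by (rule Q_cases)
    then show "\<exists>w\<in>carrier Q. v \<oplus>\<^bsub>Q\<^esub> w = \<zero>\<^bsub>Q\<^esub>"
      by (intro bexI[of _ "cls (\<ominus>\<^bsub>M\<^esub> x)"]) (auto simp: cls_add cls_closed cls_zero M.r_neg)
  qed
next
  show "\<forall>c v. c \<in> carrier R \<and> v \<in> carrier Q \<longrightarrow> c \<odot>\<^bsub>Q\<^esub> v \<in> carrier Q"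
    by (auto elim!: Q_cases simp: cls_smult cls_closed)
  show "\<forall>v w. v \<in> carrier Q \<and> w \<in> carrier Q \<longrightarrow> v \<oplus>\<^bsub>Q\<^esub> w = w \<oplus>\<^bsub>Q\<^esub> v"
    by (auto elim!: Q_cases simp: cls_add M.a_comm)
  show "\<forall>v w x. v \<in> carrier Q \<and> w \<in> carrier Q \<and> x \<in> carrier Q \<longrightarrow>
      v \<oplus>\<^bsub>Q\<^esub> w \<oplus>\<^bsub>Q\<^esub> x = v \<oplus>\<^bsub>Q\<^esub> (w \<oplus>\<^bsub>Q\<^esub> x)"
    by (auto elim!: Q_cases simp: cls_add M.a_assoc)
  show "\<forall>v\<in>carrier Q. v \<oplus>\<^bsub>Q\<^esub> \<zero>\<^bsub>Q\<^esub> = v"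
    by (auto elim!: Q_cases simp: cls_add cls_zero)
  show "\<forall>a b v. a \<in> carrier R \<and> b \<in> carrier R \<and> v \<in> carrier Q \<longrightarrow> (a \<otimes> b) \<odot>\<^bsub>Q\<^esub> v = a \<odot>\<^bsub>Q\<^esub> (b \<odot>\<^bsub>Q\<^esub> v)"
    by (auto elim!: Q_cases simp: cls_smult smult_assoc1)
  show "\<forall>v\<in>carrier Q. \<one> \<odot>\<^bsub>Q\<^esub> v = v"
    by (auto elim!: Q_cases simp: cls_smult)
  show "\<forall>a b v. a \<in> carrier R \<and> b \<in> carrier R \<and> v \<in> carrier Q \<longrightarrow>
      (a \<oplus> b) \<odot>\<^bsub>Q\<^esub> v = a \<odot>\<^bsub>Q\<^esub> v \<oplus>\<^bsub>Q\<^esub> b \<odot>\<^bsub>Q\<^esub> v"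
    by (auto elim!: Q_cases simp: cls_add cls_smult smult_l_distr)
  show "\<forall>a v w. a \<in> carrier R \<and> v \<in> carrier Q \<and> w \<in> carrier Q \<longrightarrow>
      a \<odot>\<^bsub>Q\<^esub> (v \<oplus>\<^bsub>Q\<^esub> w) = a \<odot>\<^bsub>Q\<^esub> v \<oplus>\<^bsub>Q\<^esub> a \<odot>\<^bsub>Q\<^esub> w"
    by (auto elim!: Q_cases simp: cls_add cls_smult smult_r_distr)
qed

end

lemma (in module) span_submodule_quotient:
  "A \<subseteq> carrier M \<Longrightarrow> module_quotient R M (span A)"
  by (rule module_quotient.intro[OF module_axioms
        module_quotient_axioms.intro[OF span_is_submodule]])


section \<open>Functionals\<close>

text \<open>These are the \<open>R\<close>-linear maps from \<open>M\<close> to the field \<open>K\<close>, where \<open>R\<close> acts on \<open>K\<close> through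
  a ring homomorphism \<open>ev\<close>.\<close>

definition functional ::
    "('r, 'z) ring_scheme \<Rightarrow> ('r \<Rightarrow> 'k::field) \<Rightarrow> ('r, 'm, 'y) module_scheme \<Rightarrow> ('m \<Rightarrow> 'k) \<Rightarrow> bool" where
  "functional R ev M L \<longleftrightarrow>
    (\<forall>x\<in>carrier M. \<forall>y\<in>carrier M. L (x \<oplus>\<^bsub>M\<^esub> y) = L x + L y) \<and>
    (\<forall>r\<in>carrier R. \<forall>x\<in>carrier M. L (r \<odot>\<^bsub>M\<^esub> x) = ev r * L x)"

lemma functional_add:
  "functional R ev M L \<Longrightarrow> x \<in> carrier M \<Longrightarrow> y \<in> carrier M \<Longrightarrow> L (x \<oplus>\<^bsub>M\<^esub> y) = L x + L y"
  by (simp add: functional_def)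

lemma functional_smult:
  "functional R ev M L \<Longrightarrow> r \<in> carrier R \<Longrightarrow> x \<in> carrier M \<Longrightarrow> L (r \<odot>\<^bsub>M\<^esub> x) = ev r * L x"
  by (simp add: functional_def)

lemma (in module) functional_zero:
  assumes "functional R ev M L"
  shows "L \<zero>\<^bsub>M\<^esub> = 0"
proof -
  have "L (\<zero>\<^bsub>M\<^esub> \<oplus>\<^bsub>M\<^esub> \<zero>\<^bsub>M\<^esub>) = L \<zero>\<^bsub>M\<^esub> + L \<zero>\<^bsub>M\<^esub>"
    by (intro functional_add[OF assms] M.zero_closed)
  moreover have "\<zero>\<^bsub>M\<^esub> \<oplus>\<^bsub>M\<^esub> \<zero>\<^bsub>M\<^esub> = \<zero>\<^bsub>M\<^esub>"
    by (rule M.l_zero[OF M.zero_closed])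
  ultimately show ?thesis by (simp only: add_cancel_right_right)
qed

lemma (in module) functional_minus:
  assumes "functional R ev M L" "x \<in> carrier M" "y \<in> carrier M"
  shows "L (x \<ominus>\<^bsub>M\<^esub> y) = L x - L y"
proof -
  have "x \<ominus>\<^bsub>M\<^esub> y \<in> carrier M" "x \<ominus>\<^bsub>M\<^esub> y \<oplus>\<^bsub>M\<^esub> y = x"
    using assms(2,3) by (simp_all add: a_minus_def M.a_assoc M.l_neg)
  then have "L x = L (x \<ominus>\<^bsub>M\<^esub> y) + L y"
    using functional_add[OF assms(1) _ assms(3), of "x \<ominus>\<^bsub>M\<^esub> y"] by argo
  then show ?thesis by (simp add: algebra_simps)
qed

text \<open>The kernel of a functional is a submodule. This reduces the descent to a presented
  module to a check on its relations.\<close>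

lemma (in module) functional_span:
  assumes "functional R ev M L" "A \<subseteq> carrier M" "\<And>x. x \<in> A \<Longrightarrow> L x = 0" "x \<in> span A"
  shows "L x = 0"
proof -
  have "submodule R {x \<in> carrier M. L x = 0} M"
    using assms(1) functional_zero[OF assms(1)] module_axioms
    by (unfold_locales) (auto simp: functional_def)
  then have "span A \<subseteq> {x \<in> carrier M. L x = 0}"
    by (intro span_is_subset) (use assms in auto)
  then show ?thesis using assms by auto
qed

lemma (in module_quotient) functional_quotient:
  assumes "functional R ev M L" "\<And>x. x \<in> N \<Longrightarrow> L x = 0"
  obtains L' where "functional R ev Q L'" "\<And>x. x \<in> carrier M \<Longrightarrow> L' (cls x) = L x"
proof -
  interpret A: abelian_subgroup N M by (rule submodule_abelian_subgroup[OF submodule])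
  \<comment> \<open>The value at an arbitrarily chosen representative: any other differs from it by
    an element of \<open>N\<close>, where \<open>L\<close> vanishes.\<close>
  define L' where "L' C = L (SOME x. x \<in> C)" for C
  have L': "L' (cls x) = L x" if "x \<in> carrier M" for x
  proof -
    define y where "y = (SOME y. y \<in> cls x)"
    have y: "y \<in> cls x" unfolding y_def
      by (rule someI) (rule A.a_rcos_self[OF that])
    then have yc: "y \<in> carrier M"
      using that A.a_subset by (auto simp: a_r_coset_def')
    have "y \<ominus>\<^bsub>M\<^esub> x \<in> N" using y A.a_rcos_module[OF that yc] by (simp add: a_minus_def)
    then have "L y - L x = 0" using assms(2) functional_minus[OF assms(1) yc that] by simp
    then show ?thesis by (simp add: L'_def y_def)
  qed
  have "functional R ev Q L'"
    unfolding functional_def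
    by (auto elim!: Q_cases simp: cls_add cls_smult L' functional_add[OF assms(1)]
        functional_smult[OF assms(1)])
  then show ?thesis using L' that by blast
qed

lemma ring_hom_to_class_ring:
  fixes ev :: "'r \<Rightarrow> 'k::field"
  assumes "cring R" and ev: "ev \<in> Ring.ring_hom R class_ring"
  shows "a \<in> carrier R \<Longrightarrow> b \<in> carrier R \<Longrightarrow> ev (a \<oplus>\<^bsub>R\<^esub> b) = ev a + ev b"
    and "a \<in> carrier R \<Longrightarrow> b \<in> carrier R \<Longrightarrow> ev (a \<otimes>\<^bsub>R\<^esub> b) = ev a * ev b"
    and "ev \<one>\<^bsub>R\<^esub> = 1" and "ev \<zero>\<^bsub>R\<^esub> = 0"
proof -
  show add: "ev (a \<oplus>\<^bsub>R\<^esub> b) = ev a + ev b" if "a \<in> carrier R" "b \<in> carrier R" for a b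
    using ring_hom_add[OF ev that] by simp
  show "a \<in> carrier R \<Longrightarrow> b \<in> carrier R \<Longrightarrow> ev (a \<otimes>\<^bsub>R\<^esub> b) = ev a * ev b"
    using ring_hom_mult[OF ev] by simp
  show "ev \<one>\<^bsub>R\<^esub> = 1" using ring_hom_one[OF ev] by simp
  interpret cring R by (rule assms)
  have "\<zero>\<^bsub>R\<^esub> \<in> carrier R" "\<zero>\<^bsub>R\<^esub> \<oplus>\<^bsub>R\<^esub> \<zero>\<^bsub>R\<^esub> = \<zero>\<^bsub>R\<^esub>"
    by (rule zero_closed, rule l_zero[OF zero_closed])
  then show "ev \<zero>\<^bsub>R\<^esub> = 0" using add[of "\<zero>\<^bsub>R\<^esub>" "\<zero>\<^bsub>R\<^esub>"] by (simp only: add_cancel_right_right)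
qed

lemma ring_hom_from_class_ring:
  fixes \<phi> :: "'k::field \<Rightarrow> 'r"
  assumes \<phi>: "\<phi> \<in> Ring.ring_hom class_ring R"
  shows "\<phi> c \<in> carrier R" "\<phi> (a + b) = \<phi> a \<oplus>\<^bsub>R\<^esub> \<phi> b" "\<phi> (a * b) = \<phi> a \<otimes>\<^bsub>R\<^esub> \<phi> b" "\<phi> 1 = \<one>\<^bsub>R\<^esub>"
  using ring_hom_closed[OF \<phi>, of c] ring_hom_add[OF \<phi>, of a b] ring_hom_mult[OF \<phi>, of a b]
    ring_hom_one[OF \<phi>] by simp_all

text \<open>The universal property of the free module, with target \<open>K\<close>. Together with
  \<open>functional_span\<close> and \<open>functional_quotient\<close> it produces maps out of
  every module presented here.\<close>

lemma functional_free_module: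
  fixes ev :: "'r \<Rightarrow> 'k::field"
  assumes "cring R" and ev: "ev \<in> Ring.ring_hom R class_ring"
  obtains L where "functional R ev (free_module R B) L" "\<And>b. b \<in> B \<Longrightarrow> L (free_gen R b) = g b"
proof -
  interpret cring R by (rule assms)
  note ev_hom = ring_hom_to_class_ring[OF assms]
  let ?F = "free_module R B"
  define L where "L f = (\<Sum>b | f b \<noteq> \<zero>\<^bsub>R\<^esub>. ev (f b) * g b)" for f
  \<comment> \<open>Since \<open>ev\<close> sends zero to zero, the sum may run over any finite set
    containing the support; two elements can thus share one index set.\<close>
  have L: "L f = (\<Sum>b\<in>S. ev (f b) * g b)" if "{b. f b \<noteq> \<zero>\<^bsub>R\<^esub>} \<subseteq> S" "finite S" for f S
    unfolding L_def by (rule sum.mono_neutral_left) (use that ev_hom(4) in auto)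
  have fin: "finite {b. f b \<noteq> \<zero>\<^bsub>R\<^esub>}" if "f \<in> carrier ?F" for f
    using that by (simp add: free_module_def)
  note cl = free_module_nth_closed[OF assms(1), where B = B]
  have "L (f \<oplus>\<^bsub>?F\<^esub> h) = L f + L h" if "f \<in> carrier ?F" "h \<in> carrier ?F" for f h
  proof -
    let ?S = "{b. f b \<noteq> \<zero>\<^bsub>R\<^esub>} \<union> {b. h b \<noteq> \<zero>\<^bsub>R\<^esub>}"
    have "L (f \<oplus>\<^bsub>?F\<^esub> h) = (\<Sum>b\<in>?S. ev (f b \<oplus>\<^bsub>R\<^esub> h b) * g b)"
      unfolding free_module_ops by (rule L) (use fin that in auto)
    also have "\<dots> = (\<Sum>b\<in>?S. ev (f b) * g b) + (\<Sum>b\<in>?S. ev (h b) * g b)"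
      by (simp add: ev_hom(1) cl[OF that(1)] cl[OF that(2)] algebra_simps sum.distrib)
    also have "\<dots> = L f + L h"
      using L[of f ?S] L[of h ?S] fin that by auto
    finally show ?thesis .
  qed
  moreover have "L (r \<odot>\<^bsub>?F\<^esub> f) = ev r * L f" if "r \<in> carrier R" "f \<in> carrier ?F" for r f
  proof -
    let ?S = "{b. f b \<noteq> \<zero>\<^bsub>R\<^esub>}"
    have "L (r \<odot>\<^bsub>?F\<^esub> f) = (\<Sum>b\<in>?S. ev (r \<otimes>\<^bsub>R\<^esub> f b) * g b)"
      unfolding free_module_ops by (rule L) (use fin that in auto)
    also have "\<dots> = ev r * L f"
      unfolding L_def sum_distrib_left
      by (rule sum.cong) (auto simp: ev_hom(2) that cl[OF that(2)] algebra_simps)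
    finally show ?thesis .
  qed
  moreover have "L (free_gen R b) = g b" for b
  proof -
    have "{b'. free_gen R b b' \<noteq> \<zero>\<^bsub>R\<^esub>} \<subseteq> {b}" by (auto simp: free_gen_def)
    from L[OF this] show ?thesis by (simp add: free_gen_def ev_hom(3))
  qed
  ultimately show ?thesis using that[of L] by (auto simp: functional_def)
qed


section \<open>Vector spaces\<close>

lemma restrict_scalars_vectorspace:
  fixes \<phi> :: "'k::field \<Rightarrow> 'r"
  assumes "module R M" and \<phi>: "\<phi> \<in> Ring.ring_hom class_ring R"
  shows "vectorspace class_ring (restrict_scalars \<phi> M)"
proof -
  interpret module R M by (rule assms)
  note hom = ring_hom_from_class_ring[OF \<phi>]
  let ?V = "restrict_scalars \<phi> M"
  have neg: "\<exists>w\<in>carrier M. v \<oplus>\<^bsub>M\<^esub> w = \<zero>\<^bsub>M\<^esub>" if "v \<in> carrier M" for v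
    using that by (intro bexI[of _ "\<ominus>\<^bsub>M\<^esub> v"]) (auto simp: M.r_neg)
  show ?thesis
  proof (rule vs_criteria[OF class_field])
    show "\<forall>v w. v \<in> carrier ?V \<and> w \<in> carrier ?V \<longrightarrow> v \<oplus>\<^bsub>?V\<^esub> w = w \<oplus>\<^bsub>?V\<^esub> v"
      using M.a_comm by (simp add: restrict_scalars_def)
  qed (simp_all add: restrict_scalars_def hom M.a_assoc neg
        smult_l_distr smult_r_distr smult_assoc1)
qed

lemma regular_module_module:
  assumes "cring R"
  shows "module R (regular_module R)"
proof -
  interpret cring R by (rule assms)
  let ?M = "regular_module R"
  have neg: "\<exists>w\<in>carrier R. v \<oplus>\<^bsub>R\<^esub> w = \<zero>\<^bsub>R\<^esub>" if "v \<in> carrier R" for v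
    using that by (intro bexI[of _ "\<ominus>\<^bsub>R\<^esub> v"]) (auto simp: r_neg)
  show ?thesis
  proof (rule module_criteria[OF assms])
    show "\<forall>v w. v \<in> carrier ?M \<and> w \<in> carrier ?M \<longrightarrow> v \<oplus>\<^bsub>?M\<^esub> w = w \<oplus>\<^bsub>?M\<^esub> v"
      using a_comm by (simp add: regular_module_def)
  qed (simp_all add: regular_module_def neg a_assoc m_assoc l_distr r_distr)
qed

section \<open>Dimension through dual families of functionals\<close>

lemma (in module) functional_finsum:
  assumes "cring R" "functional R ev M L" "finite J"
    and "\<And>j. j \<in> J \<Longrightarrow> c j \<in> carrier R" "\<And>j. j \<in> J \<Longrightarrow> g j \<in> carrier M"
  shows "L (\<Oplus>\<^bsub>M\<^esub> j\<in>J. c j \<odot>\<^bsub>M\<^esub> g j) = (\<Sum>j\<in>J. ev (c j) * L (g j))"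
  using assms(3-)
proof (induction J rule: finite_induct)
  case empty
  then show ?case using functional_zero[OF assms(2)] by simp
next
  case (insert j J)
  have "(\<Oplus>\<^bsub>M\<^esub> j\<in>J. c j \<odot>\<^bsub>M\<^esub> g j) \<in> carrier M"
    using insert.prems by (intro finsum_closed) auto
  with insert show ?case
    by (subst finsum_insert) (auto simp: functional_add[OF assms(2)] functional_smult[OF assms(2)])
qed

lemma (in module) finsum_submodule:
  assumes "submodule R N M" "finite J" "\<And>j. j \<in> J \<Longrightarrow> h j \<in> N"
  shows "(\<Oplus>\<^bsub>M\<^esub> j\<in>J. h j) \<in> N"
  using assms(2,3)
proof (induction J rule: finite_induct)
  case empty
  then show ?case using assms(1) by (simp add: LinearCombinations.submodule_def)
next
  case (insert j J)
  have "N \<subseteq> carrier M" using assms(1) by (simp add: LinearCombinations.submodule_def)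
  then have "h \<in> J \<rightarrow> carrier M" "h j \<in> carrier M" using insert.prems by auto
  then have "(\<Oplus>\<^bsub>M\<^esub> j\<in>insert j J. h j) = h j \<oplus>\<^bsub>M\<^esub> (\<Oplus>\<^bsub>M\<^esub> j\<in>J. h j)"
    using insert.hyps by simp
  with insert assms(1) show ?case by (simp add: LinearCombinations.submodule_def)
qed

text \<open>Applying \<open>L i\<close> to a vanishing combination isolates its coefficient at
  \<open>g i\<close>, so the family is independent; duality also makes \<open>g\<close> injective,
  so that its image has as many elements as \<open>J\<close>.\<close>

lemma dim_eq_card_dual:
  fixes V :: "('k::field, 'm) module" and L :: "'j \<Rightarrow> 'm \<Rightarrow> 'k"
  assumes V: "vectorspace class_ring V" and finJ: "finite J"
    and g: "\<And>j. j \<in> J \<Longrightarrow> g j \<in> carrier V"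
    and L: "\<And>j. j \<in> J \<Longrightarrow> functional class_ring (\<lambda>c. c) V (L j)"
    and dual: "\<And>i j. i \<in> J \<Longrightarrow> j \<in> J \<Longrightarrow> L i (g j) = (if i = j then 1 else 0)"
    and span: "carrier V \<subseteq> LinearCombinations.module.span class_ring V (g ` J)"
  shows "vectorspace.dim class_ring V = card J"
proof -
  interpret vectorspace class_ring V by (rule V)
  have inj: "inj_on g J"
  proof (rule inj_onI)
    fix i j assume "i \<in> J" "j \<in> J" "g i = g j"
    then show "i = j" using dual[of i i] dual[of i j] by (simp split: if_splits)
  qed
  have gc: "g ` J \<subseteq> carrier V" using g by auto
  have "lin_indpt (g ` J)"
  proof (rule finite_lin_indpt2)
    fix a :: "'m \<Rightarrow> 'k"
    assume lc: "lincomb a (g ` J) = \<zero>\<^bsub>V\<^esub>"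
    have "a (g i) = 0" if "i \<in> J" for i
    proof -
      have "0 = L i (\<Oplus>\<^bsub>V\<^esub> v\<in>g ` J. a v \<odot>\<^bsub>V\<^esub> v)"
        using lc functional_zero[OF L[OF that]] by (simp add: lincomb_def)
      also have "\<dots> = (\<Sum>v\<in>g ` J. a v * L i v)"
        by (rule functional_finsum[OF _ L[OF that]]) (use finJ g class_cring.is_cring in auto)
      also have "\<dots> = (\<Sum>j\<in>J. a (g j) * L i (g j))"
        using inj by (simp add: sum.reindex)
      also have "\<dots> = (\<Sum>j\<in>J. if i = j then a (g j) else 0)"
        by (rule sum.cong) (use dual that in auto)
      also have "\<dots> = a (g i)" using finJ that by simp
      finally show ?thesis by simp
    qed
    then show "\<forall>v\<in>g ` J. a v = \<zero>\<^bsub>class_ring\<^esub>" by auto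
  qed (use finJ gc in auto)
  then have "basis (g ` J)"
    unfolding basis_def using span gc span_is_subset2[OF gc] by auto
  then show ?thesis
    using dim_basis[of "g ` J"] finJ card_image[OF inj] by auto
qed

text \<open>A Gram-Schmidt step. Normalise \<open>v\<close> to \<open>u\<close> with
  \<open>L i u = 1\<close> and subtract from each \<open>g k\<close> the multiple of
  \<open>u\<close> that cancels its value under \<open>L i\<close>; as the old functionals vanish on
  \<open>v\<close>, the old dualities survive.\<close>

lemma dual_family_extend:
  fixes V :: "('k::field, 'm) module" and L :: "'j \<Rightarrow> 'm \<Rightarrow> 'k"
  assumes V: "vectorspace class_ring V"
    and L: "\<And>j. j \<in> insert i J \<Longrightarrow> functional class_ring (\<lambda>c. c) V (L j)"
    and g: "\<And>j. j \<in> J \<Longrightarrow> g j \<in> carrier V"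
    and dual: "\<And>j k. j \<in> J \<Longrightarrow> k \<in> J \<Longrightarrow> L j (g k) = (if j = k then 1 else 0)"
    and v: "v \<in> carrier V" "\<And>j. j \<in> J \<Longrightarrow> L j v = 0" "L i v \<noteq> 0"
  obtains g' where "\<And>j. j \<in> insert i J \<Longrightarrow> g' j \<in> carrier V"
    "\<And>j k. j \<in> insert i J \<Longrightarrow> k \<in> insert i J \<Longrightarrow> L j (g' k) = (if j = k then 1 else 0)"
proof -
  interpret vectorspace class_ring V by (rule V)
  have i: "i \<notin> J" using v by auto
  define u where "u = inverse (L i v) \<odot>\<^bsub>V\<^esub> v"
  have u: "u \<in> carrier V" using v by (auto simp: u_def)
  have Lu: "L j u = (if j = i then 1 else 0)" if "j \<in> insert i J" for j
    using functional_smult[OF L[OF that], of "inverse (L i v)" v] v that by (auto simp: u_def)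
  define g' where "g' k = (if k = i then u else g k \<ominus>\<^bsub>V\<^esub> L i (g k) \<odot>\<^bsub>V\<^esub> u)" for k
  have Lg': "L j (g' k) = L j (g k) - L i (g k) * L j u" if "j \<in> insert i J" "k \<in> J" for j k
  proof -
    have "k \<noteq> i" "L i (g k) \<odot>\<^bsub>V\<^esub> u \<in> carrier V" using that i u by auto
    then show ?thesis
      using functional_minus[OF L[OF that(1)] g[OF that(2)], of "L i (g k) \<odot>\<^bsub>V\<^esub> u"]
        functional_smult[OF L[OF that(1)], of "L i (g k)" u] u
      by (simp add: g'_def)
  qed
  show ?thesis
  proof (rule that[of g'])
    show "g' j \<in> carrier V" if "j \<in> insert i J" for j
      using that u g by (auto simp: g'_def)
    show "L j (g' k) = (if j = k then 1 else 0)" if "j \<in> insert i J" "k \<in> insert i J" for j k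
    proof (cases "k = i")
      case True
      then show ?thesis using Lu[OF that(1)] by (simp add: g'_def)
    next
      case False
      then show ?thesis using Lg'[OF that(1), of k] Lu[OF that(1)] that dual[of j k] i by auto
    qed
  qed
qed

text \<open>Picks a maximal independent subfamily of the functionals, with vectors dual to it: a
  functional that vanishes on the common kernel of those already chosen is discarded, any other is
  adjoined by \<open>dual_family_extend\<close>.\<close>

lemma dual_family_exists:
  fixes V :: "('k::field, 'm) module" and L :: "'j \<Rightarrow> 'm \<Rightarrow> 'k"
  assumes V: "vectorspace class_ring V" and "finite J"
    and "\<And>j. j \<in> J \<Longrightarrow> functional class_ring (\<lambda>c. c) V (L j)"
  shows "\<exists>J'\<subseteq>J. \<exists>g. (\<forall>j\<in>J'. g j \<in> carrier V) \<and>
    (\<forall>j\<in>J'. \<forall>k\<in>J'. L j (g k) = (if j = k then 1 else 0)) \<and>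
    (\<forall>v\<in>carrier V. (\<forall>j\<in>J'. L j v = 0) \<longrightarrow> (\<forall>j\<in>J. L j v = 0))"
  using assms(2,3)
proof (induction J rule: finite_induct)
  case empty
  then show ?case by auto
next
  case (insert i J)
  have "\<exists>J'\<subseteq>J. \<exists>g. (\<forall>j\<in>J'. g j \<in> carrier V) \<and>
    (\<forall>j\<in>J'. \<forall>k\<in>J'. L j (g k) = (if j = k then 1 else 0)) \<and>
    (\<forall>v\<in>carrier V. (\<forall>j\<in>J'. L j v = 0) \<longrightarrow> (\<forall>j\<in>J. L j v = 0))"
    by (rule insert.IH) (rule insert.prems, rule insertI2)
  then obtain J' g where J'1: "J' \<subseteq> J" "\<forall>j\<in>J'. g j \<in> carrier V"
      "\<forall>j\<in>J'. \<forall>k\<in>J'. L j (g k) = (if j = k then 1 else 0)"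
      "\<forall>v\<in>carrier V. (\<forall>j\<in>J'. L j v = 0) \<longrightarrow> (\<forall>j\<in>J. L j v = 0)"
    by (elim exE conjE) (rule that)
  then have J': "J' \<subseteq> J" "\<And>j. j \<in> J' \<Longrightarrow> g j \<in> carrier V"
      "\<And>j k. j \<in> J' \<Longrightarrow> k \<in> J' \<Longrightarrow> L j (g k) = (if j = k then 1 else 0)"
      "\<And>v. v \<in> carrier V \<Longrightarrow> (\<And>j. j \<in> J' \<Longrightarrow> L j v = 0) \<Longrightarrow> \<forall>j\<in>J. L j v = 0"
    by simp_all
  show ?case
  proof (cases "\<exists>v\<in>carrier V. (\<forall>j\<in>J'. L j v = 0) \<and> L i v \<noteq> 0")
    case True
    then obtain v where v: "v \<in> carrier V" "\<And>j. j \<in> J' \<Longrightarrow> L j v = 0" "L i v \<noteq> 0" by auto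
    obtain g' where "\<And>j. j \<in> insert i J' \<Longrightarrow> g' j \<in> carrier V"
        "\<And>j k. j \<in> insert i J' \<Longrightarrow> k \<in> insert i J' \<Longrightarrow> L j (g' k) = (if j = k then 1 else 0)"
      by (rule dual_family_extend[OF V _ J'(2,3) v]) (use insert.prems J'(1) in auto)
    then show ?thesis using J'(1,4)
      by (intro exI[of _ "insert i J'"] conjI exI[of _ g']) auto
  next
    case False
    then show ?thesis using J'
      by (intro exI[of _ J'] conjI exI[of _ g]) auto
  qed
qed

text \<open>A vector \<open>v\<close> and the combination of the \<open>g j\<close> with
  coefficients \<open>L j v\<close> have equal values under every functional, so separation makes
  them equal and the family spans.\<close>

lemma dim_eq_card_dual_separating:
  fixes V :: "('k::field, 'm) module" and L :: "'j \<Rightarrow> 'm \<Rightarrow> 'k"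
  assumes V: "vectorspace class_ring V" and finJ: "finite J"
    and g: "\<And>j. j \<in> J \<Longrightarrow> g j \<in> carrier V"
    and L: "\<And>j. j \<in> J \<Longrightarrow> functional class_ring (\<lambda>c. c) V (L j)"
    and dual: "\<And>i j. i \<in> J \<Longrightarrow> j \<in> J \<Longrightarrow> L i (g j) = (if i = j then 1 else 0)"
    and sep: "\<And>v. v \<in> carrier V \<Longrightarrow> (\<And>j. j \<in> J \<Longrightarrow> L j v = 0) \<Longrightarrow> v = \<zero>\<^bsub>V\<^esub>"
  shows "vectorspace.dim class_ring V = card J"
proof (rule dim_eq_card_dual[OF V finJ g L dual])
  interpret vectorspace class_ring V by (rule V)
  have gc: "g ` J \<subseteq> carrier V" using g by auto
  have sub: "submodule class_ring (span (g ` J)) V" by (rule span_is_submodule[OF gc])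
  show "carrier V \<subseteq> span (g ` J)"
  proof
    fix v assume v: "v \<in> carrier V"
    define w where "w = (\<Oplus>\<^bsub>V\<^esub> j\<in>J. L j v \<odot>\<^bsub>V\<^esub> g j)"
    have "g j \<in> span (g ` J)" if "j \<in> J" for j using in_own_span[OF gc] that by auto
    then have w: "w \<in> span (g ` J)" unfolding w_def
      using sub by (intro finsum_submodule[OF sub finJ]) (auto simp: LinearCombinations.submodule_def)
    have wc: "w \<in> carrier V" unfolding w_def using g by (intro finsum_closed) auto
    have "v \<ominus>\<^bsub>V\<^esub> w = \<zero>\<^bsub>V\<^esub>"
    proof (rule sep)
      show "v \<ominus>\<^bsub>V\<^esub> w \<in> carrier V" using v wc by simp
      fix i assume i: "i \<in> J"
      have "L i w = (\<Sum>j\<in>J. L j v * L i (g j))" unfolding w_def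
        by (rule functional_finsum[OF _ L[OF i] finJ]) (use g class_cring.is_cring in auto)
      also have "\<dots> = (\<Sum>j\<in>J. if i = j then L j v else 0)"
        by (rule sum.cong) (use dual i in auto)
      also have "\<dots> = L i v" using finJ i by simp
      finally show "L i (v \<ominus>\<^bsub>V\<^esub> w) = 0" using functional_minus[OF L[OF i] v wc] by simp
    qed
    then have "v = w" using v wc minus_other_side by blast
    then show "v \<in> span (g ` J)" using w by simp
  qed
qed auto

text \<open>For the forward direction, a maximal dual subfamily over \<open>J'\<close> already
  separates vectors, so the dimension is \<open>card J'\<close>; equality with \<open>card J\<close>
  forces \<open>J' = J\<close>. With evaluations as functionals, this extracts separators from a
  value of the Hilbert function.\<close>

lemma dim_eq_card_iff_dual:
  fixes V :: "('k::field, 'm) module" and L :: "'j \<Rightarrow> 'm \<Rightarrow> 'k"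
  assumes V: "vectorspace class_ring V" and finJ: "finite J"
    and L: "\<And>j. j \<in> J \<Longrightarrow> functional class_ring (\<lambda>c. c) V (L j)"
    and sep: "\<And>v. v \<in> carrier V \<Longrightarrow> (\<And>j. j \<in> J \<Longrightarrow> L j v = 0) \<Longrightarrow> v = \<zero>\<^bsub>V\<^esub>"
  shows "vectorspace.dim class_ring V = card J \<longleftrightarrow>
    (\<exists>g. (\<forall>j\<in>J. g j \<in> carrier V) \<and> (\<forall>j\<in>J. \<forall>k\<in>J. L j (g k) = (if j = k then 1 else 0)))"
proof
  assume dim: "vectorspace.dim class_ring V = card J"
  obtain J' g where "J' \<subseteq> J" "\<forall>j\<in>J'. g j \<in> carrier V"
      "\<forall>j\<in>J'. \<forall>k\<in>J'. L j (g k) = (if j = k then 1 else 0)"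
      "\<forall>v\<in>carrier V. (\<forall>j\<in>J'. L j v = 0) \<longrightarrow> (\<forall>j\<in>J. L j v = 0)"
    using dual_family_exists[OF V finJ, of L] L by (elim exE conjE meta_impE) (assumption, rule that)
  then have J': "J' \<subseteq> J" "\<And>j. j \<in> J' \<Longrightarrow> g j \<in> carrier V"
      "\<And>j k. j \<in> J' \<Longrightarrow> k \<in> J' \<Longrightarrow> L j (g k) = (if j = k then 1 else 0)"
      "\<And>v. v \<in> carrier V \<Longrightarrow> (\<And>j. j \<in> J' \<Longrightarrow> L j v = 0) \<Longrightarrow> \<forall>j\<in>J. L j v = 0"
    by simp_all
  have "vectorspace.dim class_ring V = card J'"
  proof (rule dim_eq_card_dual_separating[OF V finite_subset[OF J'(1) finJ] J'(2) L J'(3)])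
    show "v = \<zero>\<^bsub>V\<^esub>" if "v \<in> carrier V" "\<And>j. j \<in> J' \<Longrightarrow> L j v = 0" for v
      using sep[OF that(1)] J'(4)[OF that] by blast
  qed (use J'(1) in auto)
  then have "card J' = card J" using dim by simp
  then have "J' = J" by (rule card_subset_eq[OF finJ J'(1)])
  then show "\<exists>g. (\<forall>j\<in>J. g j \<in> carrier V) \<and> (\<forall>j\<in>J. \<forall>k\<in>J. L j (g k) = (if j = k then 1 else 0))"
    using J'(2,3) by (intro exI[of _ g]) simp
next
  assume "\<exists>g. (\<forall>j\<in>J. g j \<in> carrier V) \<and> (\<forall>j\<in>J. \<forall>k\<in>J. L j (g k) = (if j = k then 1 else 0))"
  then obtain g where "\<forall>j\<in>J. g j \<in> carrier V"
      "\<forall>j\<in>J. \<forall>k\<in>J. L j (g k) = (if j = k then 1 else 0)"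
    by (elim exE conjE)
  then show "vectorspace.dim class_ring V = card J"
    by (intro dim_eq_card_dual_separating[OF V finJ _ L _ sep, of g]) (blast | simp only:)+
qed

section \<open>Kaehler differentials and exterior powers\<close>

locale field_algebra = cring R for R (structure) +
  fixes \<phi> :: "'k::field \<Rightarrow> 'a"
  assumes const_hom: "\<phi> \<in> Ring.ring_hom class_ring R"
begin

abbreviation \<Omega> where "\<Omega> \<equiv> kaehler R \<phi>"
abbreviation d where "d \<equiv> kaehler_d R \<phi>"
abbreviation F where "F \<equiv> free_module R (carrier R)"

lemmas const_simps = ring_hom_from_class_ring[OF const_hom]

interpretation F: module R F by (rule free_module_module[OF is_cring])

lemma F_gen_closed: "x \<in> carrier R \<Longrightarrow> free_gen R x \<in> carrier F"
  by (rule free_gen_closed[OF is_cring])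

lemma kaehler_relations_closed: "kaehler_relations R \<phi> \<subseteq> carrier F"
  unfolding kaehler_relations_def Let_def
  using F_gen_closed const_simps(1) by fastforce

interpretation K: module_quotient R F "kaehler_submodule R \<phi>"
  unfolding kaehler_submodule_def by (rule F.span_submodule_quotient[OF kaehler_relations_closed])

lemma kaehler_module: "module R \<Omega>"
  unfolding kaehler_def by (rule K.Q_module)

lemma kaehler_relations_submodule: "kaehler_relations R \<phi> \<subseteq> kaehler_submodule R \<phi>"
  unfolding kaehler_submodule_def by (rule F.in_own_span[OF kaehler_relations_closed])

lemma d_closed: "x \<in> carrier R \<Longrightarrow> d x \<in> carrier \<Omega>"
  unfolding kaehler_d_def kaehler_def by (intro K.cls_closed F_gen_closed)

lemma d_add:
  assumes "x \<in> carrier R" "y \<in> carrier R"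
  shows "d (x \<oplus> y) = d x \<oplus>\<^bsub>\<Omega>\<^esub> d y"
proof -
  have "free_gen R (x \<oplus> y) \<ominus>\<^bsub>F\<^esub> (free_gen R x \<oplus>\<^bsub>F\<^esub> free_gen R y) \<in> kaehler_relations R \<phi>"
    unfolding kaehler_relations_def Let_def using assms by blast
  then have "K.cls (free_gen R (x \<oplus> y)) = K.cls (free_gen R x \<oplus>\<^bsub>F\<^esub> free_gen R y)"
    using kaehler_relations_submodule assms by (subst K.cls_eq_iff) (auto simp: F_gen_closed)
  then show ?thesis
    using assms by (simp add: kaehler_d_def kaehler_def K.cls_add F_gen_closed)
qed

lemma d_mult:
  assumes "x \<in> carrier R" "y \<in> carrier R"
  shows "d (x \<otimes> y) = x \<odot>\<^bsub>\<Omega>\<^esub> d y \<oplus>\<^bsub>\<Omega>\<^esub> y \<odot>\<^bsub>\<Omega>\<^esub> d x"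
proof -
  let ?r = "x \<odot>\<^bsub>F\<^esub> free_gen R y \<oplus>\<^bsub>F\<^esub> y \<odot>\<^bsub>F\<^esub> free_gen R x"
  have "free_gen R (x \<otimes> y) \<ominus>\<^bsub>F\<^esub> ?r \<in> kaehler_relations R \<phi>"
    unfolding kaehler_relations_def Let_def using assms by blast
  then have "K.cls (free_gen R (x \<otimes> y)) = K.cls ?r"
    using kaehler_relations_submodule assms by (subst K.cls_eq_iff) (auto simp: F_gen_closed)
  then show ?thesis
    using assms by (simp add: kaehler_d_def kaehler_def K.cls_add K.cls_smult F_gen_closed)
qed

lemma d_const: "d (\<phi> c) = \<zero>\<^bsub>\<Omega>\<^esub>"
proof -
  have "free_gen R (\<phi> c) \<in> kaehler_relations R \<phi>"
    unfolding kaehler_relations_def Let_def by blast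
  then show ?thesis
    using kaehler_relations_submodule const_simps(1)
    unfolding kaehler_d_def kaehler_def by (subst K.cls_eq_zero_iff) (auto simp: F_gen_closed)
qed

text \<open>The universal property of the differentials, for derivations into \<open>K\<close> over
  \<open>ev\<close>. The functional on the free module with value \<open>D x\<close> at the
  generator of \<open>x\<close> kills the three kinds of relations by additivity, by the Leibniz
  rule and by the vanishing on constants.\<close>

lemma functional_kaehler:
  fixes ev D :: "'a \<Rightarrow> 'k"
  assumes ev: "ev \<in> Ring.ring_hom R class_ring"
    and add: "\<And>x y. x \<in> carrier R \<Longrightarrow> y \<in> carrier R \<Longrightarrow> D (x \<oplus> y) = D x + D y"
    and mult: "\<And>x y. x \<in> carrier R \<Longrightarrow> y \<in> carrier R \<Longrightarrow> D (x \<otimes> y) = ev x * D y + ev y * D x"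
    and const: "\<And>c. D (\<phi> c) = 0"
  obtains L where "functional R ev \<Omega> L" "\<And>x. x \<in> carrier R \<Longrightarrow> L (d x) = D x"
proof -
  obtain L where L: "functional R ev F L" "\<And>x. x \<in> carrier R \<Longrightarrow> L (free_gen R x) = D x"
    by (rule functional_free_module[OF is_cring ev, of "carrier R" D]) (rule that)
  have "L x = 0" if x: "x \<in> kaehler_relations R \<phi>" for x
  proof -
    note fs = F.functional_minus[OF L(1)] functional_add[OF L(1)] functional_smult[OF L(1)]
      L(2) F_gen_closed add mult const const_simps(1)
    from x consider
      (a) u v where "x = free_gen R (u \<oplus> v) \<ominus>\<^bsub>F\<^esub> (free_gen R u \<oplus>\<^bsub>F\<^esub> free_gen R v)"
          "u \<in> carrier R" "v \<in> carrier R"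
      | (b) u v where "x = free_gen R (u \<otimes> v) \<ominus>\<^bsub>F\<^esub>
            (u \<odot>\<^bsub>F\<^esub> free_gen R v \<oplus>\<^bsub>F\<^esub> v \<odot>\<^bsub>F\<^esub> free_gen R u)"
          "u \<in> carrier R" "v \<in> carrier R"
      | (c) c where "x = free_gen R (\<phi> c)"
      unfolding kaehler_relations_def Let_def by blast
    then show ?thesis
    proof cases
      case a
      then show ?thesis by (simp add: fs)
    next
      case b
      then show ?thesis by (simp add: fs)
    next
      case c
      then show ?thesis by (simp add: fs)
    qed
  qed
  then have "L x = 0" if "x \<in> kaehler_submodule R \<phi>" for x
    using F.functional_span[OF L(1) kaehler_relations_closed] that
    unfolding kaehler_submodule_def by blast
  then obtain L' where L': "functional R ev K.Q L'" "\<And>x. x \<in> carrier F \<Longrightarrow> L' (K.cls x) = L x"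
    using K.functional_quotient[OF L(1)] by blast
  show ?thesis
  proof (rule that[of L'])
    show "functional R ev \<Omega> L'" using L'(1) by (simp add: kaehler_def)
    show "L' (d x) = D x" if "x \<in> carrier R" for x
      using that by (simp add: kaehler_d_def L'(2) F_gen_closed L(2))
  qed
qed

end

section \<open>Exterior powers and maps out of them\<close>

context module
begin

abbreviation E where "E m \<equiv> free_module R (tuples M m)"

lemma E_module: "module R (E m)"
  by (rule free_module_module[OF R.is_cring])

lemma tuples_update: "xs \<in> tuples M m \<Longrightarrow> x \<in> carrier M \<Longrightarrow> xs[i := x] \<in> tuples M m"
  using set_update_subset_insert[of xs i x] by (auto simp: tuples_def)

lemma E_gen_closed: "xs \<in> tuples M m \<Longrightarrow> free_gen R xs \<in> carrier (E m)"
  by (rule free_gen_closed[OF R.is_cring])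

lemma ext_relations_closed: "ext_relations R M m \<subseteq> carrier (E m)"
proof -
  interpret E: module R "E m" by (rule E_module)
  show ?thesis
  proof
    fix z assume "z \<in> ext_relations R M m"
    then consider
      (a) xs i x y where "z = free_gen R (xs[i := x \<oplus>\<^bsub>M\<^esub> y]) \<ominus>\<^bsub>E m\<^esub>
            (free_gen R (xs[i := x]) \<oplus>\<^bsub>E m\<^esub> free_gen R (xs[i := y]))"
          "xs \<in> tuples M m" "x \<in> carrier M" "y \<in> carrier M"
      | (b) xs i r x where "z = free_gen R (xs[i := r \<odot>\<^bsub>M\<^esub> x]) \<ominus>\<^bsub>E m\<^esub> r \<odot>\<^bsub>E m\<^esub> free_gen R (xs[i := x])"
          "xs \<in> tuples M m" "r \<in> carrier R" "x \<in> carrier M"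
      | (c) xs where "z = free_gen R xs" "xs \<in> tuples M m"
      unfolding ext_relations_def Let_def by blast
    then show "z \<in> carrier (E m)"
    proof cases
      case a
      then show ?thesis by (simp add: E_gen_closed tuples_update)
    next
      case b
      then show ?thesis by (simp add: E_gen_closed tuples_update)
    next
      case c
      then show ?thesis by (simp add: E_gen_closed)
    qed
  qed
qed

lemma ext_quotient: "module_quotient R (E m) (ext_submodule R M m)"
  unfolding ext_submodule_def
  by (rule module.span_submodule_quotient[OF E_module ext_relations_closed])

lemma ext_power_module: "module R (ext_power R M m)"
  unfolding ext_power_def by (rule module_quotient.Q_module[OF ext_quotient])

lemma ext_relations_submodule: "ext_relations R M m \<subseteq> ext_submodule R M m"
  unfolding ext_submodule_def by (rule module.in_own_span[OF E_module ext_relations_closed])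

lemma wedge_closed:
  assumes "xs \<in> tuples M m"
  shows "wedge R M xs \<in> carrier (ext_power R M m)"
proof -
  interpret X: module_quotient R "E m" "ext_submodule R M m" by (rule ext_quotient)
  have "length xs = m" using assms by (simp add: tuples_def)
  then show ?thesis
    using X.cls_closed[OF E_gen_closed[OF assms]] by (simp add: wedge_def ext_power_def)
qed

lemma wedge_add:
  assumes "xs \<in> tuples M m" "i < m" "x \<in> carrier M" "y \<in> carrier M"
  shows "wedge R M (xs[i := x \<oplus>\<^bsub>M\<^esub> y]) =
    wedge R M (xs[i := x]) \<oplus>\<^bsub>ext_power R M m\<^esub> wedge R M (xs[i := y])"
proof -
  interpret X: module_quotient R "E m" "ext_submodule R M m" by (rule ext_quotient)
  have "free_gen R (xs[i := x \<oplus>\<^bsub>M\<^esub> y]) \<ominus>\<^bsub>E m\<^esub>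
      (free_gen R (xs[i := x]) \<oplus>\<^bsub>E m\<^esub> free_gen R (xs[i := y])) \<in> ext_relations R M m"
    unfolding ext_relations_def Let_def using assms by blast
  then have "X.cls (free_gen R (xs[i := x \<oplus>\<^bsub>M\<^esub> y])) =
      X.cls (free_gen R (xs[i := x]) \<oplus>\<^bsub>E m\<^esub> free_gen R (xs[i := y]))"
    using ext_relations_submodule[of m] assms
    by (subst X.cls_eq_iff) (auto simp: E_gen_closed tuples_update)
  moreover have "length xs = m" using assms by (simp add: tuples_def)
  ultimately show ?thesis
    using assms by (simp add: wedge_def ext_power_def X.cls_add E_gen_closed tuples_update)
qed

lemma wedge_smult:
  assumes "xs \<in> tuples M m" "i < m" "r \<in> carrier R" "x \<in> carrier M"
  shows "wedge R M (xs[i := r \<odot>\<^bsub>M\<^esub> x]) = r \<odot>\<^bsub>ext_power R M m\<^esub> wedge R M (xs[i := x])"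
proof -
  interpret X: module_quotient R "E m" "ext_submodule R M m" by (rule ext_quotient)
  have "free_gen R (xs[i := r \<odot>\<^bsub>M\<^esub> x]) \<ominus>\<^bsub>E m\<^esub> r \<odot>\<^bsub>E m\<^esub> free_gen R (xs[i := x])
      \<in> ext_relations R M m"
    unfolding ext_relations_def Let_def using assms by blast
  then have "X.cls (free_gen R (xs[i := r \<odot>\<^bsub>M\<^esub> x])) = X.cls (r \<odot>\<^bsub>E m\<^esub> free_gen R (xs[i := x]))"
    using ext_relations_submodule[of m] assms
    by (subst X.cls_eq_iff) (auto simp: E_gen_closed tuples_update)
  moreover have "length xs = m" using assms by (simp add: tuples_def)
  ultimately show ?thesis
    using assms by (simp add: wedge_def ext_power_def X.cls_smult E_gen_closed tuples_update)
qed

lemma wedge_eq_entries: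
  assumes "xs \<in> tuples M m" "i < j" "j < m" "xs ! i = xs ! j"
  shows "wedge R M xs = \<zero>\<^bsub>ext_power R M m\<^esub>"
proof -
  interpret X: module_quotient R "E m" "ext_submodule R M m" by (rule ext_quotient)
  have "free_gen R xs \<in> ext_relations R M m"
    unfolding ext_relations_def Let_def using assms by blast
  then have "X.cls (free_gen R xs) = \<zero>\<^bsub>X.Q\<^esub>"
    using ext_relations_submodule[of m] assms
    by (subst X.cls_eq_zero_iff) (auto simp: E_gen_closed)
  moreover have "length xs = m" using assms by (simp add: tuples_def)
  ultimately show ?thesis by (simp add: wedge_def ext_power_def)
qed

text \<open>Only the first power calls for maps to \<open>K\<close>: the higher powers are shown to
  vanish in the relevant degrees, where spanning is enough.\<close>

lemma functional_ext_power_1: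
  fixes ev :: "'a \<Rightarrow> 'k::field"
  assumes ev: "ev \<in> Ring.ring_hom R class_ring" and L: "functional R ev M L"
  obtains L' where "functional R ev (ext_power R M 1) L'"
    "\<And>x. x \<in> carrier M \<Longrightarrow> L' (wedge R M [x]) = L x"
proof -
  interpret X: module_quotient R "E 1" "ext_submodule R M 1" by (rule ext_quotient)
  obtain G where G: "functional R ev (E 1) G"
      "\<And>xs. xs \<in> tuples M 1 \<Longrightarrow> G (free_gen R xs) = L (hd xs)"
    by (rule functional_free_module[OF R.is_cring ev, of "tuples M 1" "\<lambda>xs. L (hd xs)"]) (rule that)
  have tup: "[x] \<in> tuples M 1" if "x \<in> carrier M" for x using that by (simp add: tuples_def)
  have upd: "xs[0 := x] = [x]" if "xs \<in> tuples M 1" for xs x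
    using that by (cases xs) (auto simp: tuples_def)
  note fs = X.functional_minus[OF G(1)] functional_add[OF G(1)] functional_smult[OF G(1)]
    functional_add[OF L] functional_smult[OF L] G(2)[OF tup] E_gen_closed[OF tup]
  have "G z = 0" if z: "z \<in> ext_relations R M 1" for z
  proof -
    \<comment> \<open>The alternating relations ask for \<open>i < j\<close> and
      \<open>j < 1\<close>, so there are none; multilinearity concerns position 0 alone.\<close>
    from z consider
      (a) xs x y where "z = free_gen R (xs[0 := x \<oplus>\<^bsub>M\<^esub> y]) \<ominus>\<^bsub>E 1\<^esub>
            (free_gen R (xs[0 := x]) \<oplus>\<^bsub>E 1\<^esub> free_gen R (xs[0 := y]))"
          "xs \<in> tuples M 1" "x \<in> carrier M" "y \<in> carrier M"
      | (b) xs r x where "z = free_gen R (xs[0 := r \<odot>\<^bsub>M\<^esub> x]) \<ominus>\<^bsub>E 1\<^esub> r \<odot>\<^bsub>E 1\<^esub> free_gen R (xs[0 := x])"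
          "xs \<in> tuples M 1" "r \<in> carrier R" "x \<in> carrier M"
      unfolding ext_relations_def Let_def by auto
    then show ?thesis
    proof cases
      case a
      then show ?thesis by (simp add: upd fs del: One_nat_def)
    next
      case b
      then show ?thesis by (simp add: upd fs del: One_nat_def)
    qed
  qed
  then have "G z = 0" if "z \<in> ext_submodule R M 1" for z
    using X.functional_span[OF G(1) ext_relations_closed] that
    unfolding ext_submodule_def by blast
  then obtain L' where L': "functional R ev X.Q L'" "\<And>x. x \<in> carrier (E 1) \<Longrightarrow> L' (X.cls x) = G x"
    using X.functional_quotient[OF G(1)] by blast
  show ?thesis
  proof (rule that[of L'])
    show "functional R ev (ext_power R M 1) L'" using L'(1) by (simp add: ext_power_def)
    show "L' (wedge R M [x]) = L x" if "x \<in> carrier M" for x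
      using that L'(2)[OF E_gen_closed[OF tup[OF that]]] by (simp add: wedge_def G(2)[OF tup])
  qed
qed

end

section \<open>Graded algebras with separating points\<close>

lemma restrict_scalars_simps [simp]:
  "carrier (restrict_scalars \<phi> M) = carrier M"
  "\<zero>\<^bsub>restrict_scalars \<phi> M\<^esub> = \<zero>\<^bsub>M\<^esub>"
  "u \<oplus>\<^bsub>restrict_scalars \<phi> M\<^esub> v = u \<oplus>\<^bsub>M\<^esub> v"
  "c \<odot>\<^bsub>restrict_scalars \<phi> M\<^esub> v = \<phi> c \<odot>\<^bsub>M\<^esub> v"
  by (simp_all add: restrict_scalars_def)

text \<open>The points are the \<open>j \<in> J\<close>; \<open>ev j\<close> is the evaluation at a representative whose zeroth
  coordinate is \<open>1\<close>, and \<open>D j\<close> is the Euler derivation followed by this evaluation.\<close>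

locale points_algebra = field_algebra R \<phi> for R (structure) and \<phi> :: "'k::field \<Rightarrow> 'a" +
  fixes gr :: "int \<Rightarrow> 'a set" and x :: "nat \<Rightarrow> 'a" and n :: nat
    and J :: "'p set" and ev D :: "'p \<Rightarrow> 'a \<Rightarrow> 'k"
  assumes gr_closed: "a \<in> gr i \<Longrightarrow> a \<in> carrier R"
    and gr_zero: "\<zero> \<in> gr i"
    and gr_add: "a \<in> gr i \<Longrightarrow> b \<in> gr i \<Longrightarrow> a \<oplus> b \<in> gr i"
    and gr_mult: "a \<in> gr i \<Longrightarrow> b \<in> gr j \<Longrightarrow> a \<otimes> b \<in> gr (i + j)"
    and gr_const: "\<phi> c \<in> gr 0"
    and gr_neg: "i < 0 \<Longrightarrow> a \<in> gr i \<Longrightarrow> a = \<zero>"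
    and gr_0: "a \<in> gr 0 \<Longrightarrow> \<exists>c. a = \<phi> c"
    and gr_induct: "\<And>P. \<lbrakk>i > 0; a \<in> gr i; P \<zero>;
        \<And>b c. b \<in> gr i \<Longrightarrow> c \<in> gr i \<Longrightarrow> P b \<Longrightarrow> P c \<Longrightarrow> P (b \<oplus> c);
        \<And>k b. k \<le> n \<Longrightarrow> b \<in> gr (i - 1) \<Longrightarrow> P (x k \<otimes> b)\<rbrakk> \<Longrightarrow> P a"
    and x_gr: "k \<le> n \<Longrightarrow> x k \<in> gr 1"
    and finite_points: "finite J"
    and ev_hom: "q \<in> J \<Longrightarrow> ev q \<in> Ring.ring_hom R class_ring"
    and ev_const: "q \<in> J \<Longrightarrow> ev q (\<phi> c) = c"
    and ev_x0: "q \<in> J \<Longrightarrow> ev q (x 0) = 1"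
    and ev_separates: "a \<in> gr i \<Longrightarrow> (\<And>q. q \<in> J \<Longrightarrow> ev q a = 0) \<Longrightarrow> a = \<zero>"
    and x_separates: "p \<in> J \<Longrightarrow> q \<in> J \<Longrightarrow> p \<noteq> q \<Longrightarrow> \<exists>k\<le>n. ev p (x k) \<noteq> ev q (x k)"
    and D_add: "q \<in> J \<Longrightarrow> a \<in> carrier R \<Longrightarrow> b \<in> carrier R \<Longrightarrow> D q (a \<oplus> b) = D q a + D q b"
    and D_mult: "q \<in> J \<Longrightarrow> a \<in> carrier R \<Longrightarrow> b \<in> carrier R \<Longrightarrow>
        D q (a \<otimes> b) = ev q a * D q b + ev q b * D q a"
    and D_const: "q \<in> J \<Longrightarrow> D q (\<phi> c) = 0"
    and D_x0: "q \<in> J \<Longrightarrow> D q (x 0) = 1"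
begin

sublocale Om: module R \<Omega> by (rule kaehler_module)

lemma x_closed: "k \<le> n \<Longrightarrow> x k \<in> carrier R"
  by (rule gr_closed[OF x_gr])

lemma const_zero: "\<phi> 0 = \<zero>"
proof -
  have "\<phi> 0 \<oplus> \<phi> 0 = \<phi> 0" using const_simps(2)[of 0 0] by simp
  then show ?thesis using const_simps(1)[of 0] by simp
qed

lemma gr_smult: "a \<in> gr i \<Longrightarrow> \<phi> c \<otimes> a \<in> gr i"
  using gr_mult[OF gr_const] by fastforce

lemma gr_one: "\<one> \<in> gr 0"
  using gr_const[of 1] const_simps(4) by simp

lemmas ev_simps = ring_hom_to_class_ring[OF is_cring ev_hom]

text \<open>The tool for identities between separators. The difference is formed with the constant
  -1, because closure of the graded pieces under negation is only available through
  constants.\<close>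

lemma ev_eqI:
  assumes a: "a \<in> gr i" and b: "b \<in> gr i" and ev: "\<And>j. j \<in> J \<Longrightarrow> ev j a = ev j b"
  shows "a = b"
proof -
  have b': "\<phi> (-1) \<otimes> b \<in> gr i" by (rule gr_smult[OF b])
  note cl = gr_closed[OF a] gr_closed[OF b] gr_closed[OF b'] const_simps(1)
  have "a \<oplus> \<phi> (-1) \<otimes> b = \<zero>"
  proof (rule ev_separates[OF gr_add[OF a b']])
    fix j assume j: "j \<in> J"
    show "ev j (a \<oplus> \<phi> (-1) \<otimes> b) = 0"
      by (simp add: ev_simps[OF j] ev_const[OF j] ev[OF j] cl)
  qed
  moreover have "b \<oplus> \<phi> (-1) \<otimes> b = \<zero>"
  proof -
    have "b \<oplus> \<phi> (-1) \<otimes> b = (\<phi> 1 \<oplus> \<phi> (-1)) \<otimes> b"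
      using cl by (simp add: l_distr const_simps(4))
    also have "\<phi> 1 \<oplus> \<phi> (-1) = \<zero>" using const_simps(2)[of 1 "-1"] const_zero by simp
    finally show ?thesis using cl by simp
  qed
  ultimately show ?thesis using add.right_cancel[OF cl(3,1,2)] by simp
qed

subsection \<open>Generation of the graded pieces\<close>

text \<open>Sums of forms \<open>a dx_k\<close> with \<open>a\<close> of degree
  \<open>i - 1\<close>, so of total degree \<open>i\<close>. Building the sum one term at a time
  gives the induction by which a wedge product is expanded in one of its entries.\<close>

inductive dspan :: "int \<Rightarrow> ('a \<Rightarrow> 'a) set \<Rightarrow> bool" for i where
  dspan_zero: "dspan i \<zero>\<^bsub>\<Omega>\<^esub>"
| dspan_insert: "a \<in> gr (i - 1) \<Longrightarrow> k \<le> n \<Longrightarrow> dspan i w \<Longrightarrow> dspan i (a \<odot>\<^bsub>\<Omega>\<^esub> d (x k) \<oplus>\<^bsub>\<Omega>\<^esub> w)"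

lemma dx_closed: "k \<le> n \<Longrightarrow> d (x k) \<in> carrier \<Omega>"
  by (rule d_closed[OF x_closed])

lemma dspan_closed: "dspan i w \<Longrightarrow> w \<in> carrier \<Omega>"
  by (induction rule: dspan.induct) (auto intro: Om.smult_closed gr_closed dx_closed)

lemma dspan_single:
  assumes "a \<in> gr (i - 1)" "k \<le> n"
  shows "dspan i (a \<odot>\<^bsub>\<Omega>\<^esub> d (x k))"
proof -
  have "a \<odot>\<^bsub>\<Omega>\<^esub> d (x k) \<in> carrier \<Omega>"
    using gr_closed[OF assms(1)] dx_closed[OF assms(2)] by simp
  then show ?thesis using dspan_insert[OF assms dspan_zero] by simp
qed

lemma dspan_add:
  assumes "dspan i v" "dspan i w"
  shows "dspan i (v \<oplus>\<^bsub>\<Omega>\<^esub> w)"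
  using assms(1)
proof (induction rule: dspan.induct)
  case dspan_zero
  then show ?case using assms(2) dspan_closed[OF assms(2)] by simp
next
  case (dspan_insert a k v)
  have "a \<odot>\<^bsub>\<Omega>\<^esub> d (x k) \<in> carrier \<Omega>"
    using gr_closed[OF dspan_insert(1)] dx_closed[OF dspan_insert(2)] by simp
  then show ?case
    using dspan.dspan_insert[OF dspan_insert(1,2,4)] dspan_closed[OF dspan_insert(3)]
      dspan_closed[OF assms(2)] by (simp add: Om.M.a_assoc)
qed

lemma dspan_smult:
  assumes "dspan i w" "b \<in> gr j"
  shows "dspan (i + j) (b \<odot>\<^bsub>\<Omega>\<^esub> w)"
  using assms(1)
proof (induction rule: dspan.induct)
  case dspan_zero
  then show ?case using gr_closed[OF assms(2)] dspan.dspan_zero by simp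
next
  case (dspan_insert a k w)
  have "b \<otimes> a \<in> gr (i + j - 1)"
    using gr_mult[OF assms(2) dspan_insert(1)] by (simp add: algebra_simps)
  from dspan.dspan_insert[OF this dspan_insert(2,4)] show ?case
    using gr_closed[OF dspan_insert(1)] dx_closed[OF dspan_insert(2)] gr_closed[OF assms(2)]
      dspan_closed[OF dspan_insert(3)] by (simp add: Om.smult_r_distr Om.smult_assoc1)
qed

lemma d_zero: "d \<zero> = \<zero>\<^bsub>\<Omega>\<^esub>"
  using d_const[of 0] const_zero by simp

text \<open>Induction on the degree: an element of positive degree is a sum of products
  \<open>x k \<otimes> b\<close>, and the Leibniz rule turns each into \<open>x k\<close> times
  \<open>d b\<close> plus \<open>b\<close> times \<open>d (x k)\<close>. In degree zero there are
  only constants, and \<open>d\<close> kills them.\<close>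

lemma d_dspan_nat: "a \<in> gr (int m) \<Longrightarrow> dspan (int m) (d a)"
proof (induction m arbitrary: a)
  case 0
  then obtain c where "a = \<phi> c" using gr_0 by auto
  then show ?case using d_const dspan_zero by simp
next
  case (Suc m)
  show ?case
  proof (rule gr_induct[of "int (Suc m)" a "\<lambda>a. dspan (int (Suc m)) (d a)"])
    show "dspan (int (Suc m)) (d (b \<oplus> c))"
      if "b \<in> gr (int (Suc m))" "c \<in> gr (int (Suc m))"
        "dspan (int (Suc m)) (d b)" "dspan (int (Suc m)) (d c)" for b c
      using dspan_add[OF that(3,4)] d_add[OF gr_closed[OF that(1)] gr_closed[OF that(2)]] by simp
    show "dspan (int (Suc m)) (d (x k \<otimes> b))"
      if k: "k \<le> n" and b: "b \<in> gr (int (Suc m) - 1)" for k b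
    proof -
      have "dspan (int m + 1) (x k \<odot>\<^bsub>\<Omega>\<^esub> d b)"
        by (rule dspan_smult[OF Suc.IH x_gr[OF k]]) (use b in simp)
      then have "dspan (int (Suc m)) (x k \<odot>\<^bsub>\<Omega>\<^esub> d b)" by (simp add: algebra_simps)
      from dspan_add[OF this dspan_single[OF b k]] show ?thesis
        by (simp add: d_mult[OF x_closed[OF k] gr_closed[OF b]])
    qed
  qed (use Suc.prems d_zero dspan_zero in auto)
qed

lemma d_dspan:
  assumes "a \<in> gr i"
  shows "dspan i (d a)"
proof (cases "i < 0")
  case True
  then show ?thesis using gr_neg[OF True assms] d_zero dspan_zero by simp
next
  case False
  then show ?thesis using d_dspan_nat[of a "nat i"] assms by simp
qed

abbreviation gr_\<Omega> where "gr_\<Omega> \<equiv> kaehler_grading R \<phi> gr"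

lemma kaehler_vectorspace: "vectorspace class_ring (restrict_scalars \<phi> \<Omega>)"
  by (rule restrict_scalars_vectorspace[OF kaehler_module const_hom])

text \<open>Constants have degree 0, so \<open>dspan i\<close> is a \<open>K\<close>-subspace; it
  contains the spanning forms \<open>a dy\<close> by \<open>d_dspan\<close>. From here on only
  differentials of variables have to be considered.\<close>

lemma kaehler_grading_dspan: "w \<in> gr_\<Omega> i \<Longrightarrow> dspan i w"
proof -
  interpret V: vectorspace class_ring "restrict_scalars \<phi> \<Omega>" by (rule kaehler_vectorspace)
  have "submodule class_ring {w. dspan i w} (restrict_scalars \<phi> \<Omega>)"
  proof (unfold_locales, goal_cases)
    case 1 then show ?case using dspan_closed by auto
  next
    case (4 c v) then show ?case using dspan_smult[OF _ gr_const] by fastforce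
  qed (auto intro: dspan_add dspan_zero)
  moreover have "dspan i (a \<odot>\<^bsub>\<Omega>\<^esub> d y)" if "a \<in> gr j" "y \<in> gr k" "j + k = i" for a y j k
    using dspan_smult[OF d_dspan[OF that(2)] that(1)] that(3) by (simp add: algebra_simps)
  ultimately have "gr_\<Omega> i \<subseteq> {w. dspan i w}"
    unfolding kaehler_grading_def by (intro V.span_is_subset) auto
  then show "w \<in> gr_\<Omega> i \<Longrightarrow> dspan i w" by auto
qed

lemma kaehler_grading_dx:
  assumes "a \<in> gr (i - 1)" "k \<le> n"
  shows "a \<odot>\<^bsub>\<Omega>\<^esub> d (x k) \<in> gr_\<Omega> i"
proof -
  interpret V: vectorspace class_ring "restrict_scalars \<phi> \<Omega>" by (rule kaehler_vectorspace)
  let ?G = "{a \<odot>\<^bsub>\<Omega>\<^esub> d y | a y j k. a \<in> gr j \<and> y \<in> gr k \<and> j + k = i}"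
  have "?G \<subseteq> carrier (restrict_scalars \<phi> \<Omega>)"
    by (auto intro!: Om.smult_closed d_closed dest: gr_closed)
  then have "?G \<subseteq> gr_\<Omega> i" unfolding kaehler_grading_def by (rule V.in_own_span)
  moreover have "a \<odot>\<^bsub>\<Omega>\<^esub> d (x k) \<in> ?G"
    using assms(1) x_gr[OF assms(2)] by force
  ultimately show ?thesis by (rule subsetD)
qed

section \<open>Graded pieces of the exterior powers\<close>

abbreviation EP where "EP m \<equiv> ext_power R \<Omega> m"
abbreviation W where "W \<equiv> wedge R \<Omega>"
abbreviation gr_E where "gr_E m \<equiv> ext_grading R \<phi> \<Omega> gr_\<Omega> m"
abbreviation EV where "EV m \<equiv> restrict_scalars \<phi> (EP m)"
abbreviation dxs where "dxs ks \<equiv> map (\<lambda>k. d (x k)) ks"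

lemma EV_vectorspace: "vectorspace class_ring (EV m)"
  by (rule restrict_scalars_vectorspace[OF Om.ext_power_module const_hom])

lemma dxs_tuples: "length ks = m \<Longrightarrow> set ks \<subseteq> {..n} \<Longrightarrow> dxs ks \<in> tuples \<Omega> m"
  by (auto simp: tuples_def dx_closed)

definition ext_gens where
  "ext_gens m i = {W ws | ws ds. length ws = m \<and> length ds = m \<and>
     (\<forall>l<m. ws ! l \<in> gr_\<Omega> (ds ! l)) \<and> sum_list ds = i}"

lemma ext_grading_span:
  "gr_E m i = LinearCombinations.module.span class_ring (EV m) (ext_gens m i)"
  by (simp add: ext_grading_def ext_gens_def)

lemma ext_gens_closed: "ext_gens m i \<subseteq> carrier (EV m)"
proof -
  have "ws \<in> tuples \<Omega> m" if "length ws = m" "\<forall>l<m. ws ! l \<in> gr_\<Omega> (ds ! l)" for ws ds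
    using that kaehler_grading_dspan dspan_closed by (fastforce simp: tuples_def in_set_conv_nth)
  then show ?thesis by (auto simp: ext_gens_def intro!: Om.wedge_closed)
qed

lemma ext_grading_submodule: "submodule class_ring (gr_E m i) (EV m)"
proof -
  interpret V: vectorspace class_ring "EV m" by (rule EV_vectorspace)
  show ?thesis unfolding ext_grading_span by (rule V.span_is_submodule[OF ext_gens_closed])
qed

text \<open>Multilinear expansion by induction on \<open>p\<close>: the entries from position \<open>p\<close> on are already
  differentials of variables.\<close>

lemma ext_grading_expand:
  assumes N: "submodule class_ring N (EV m)"
    and gens: "\<And>a ks. a \<in> gr (i - int m) \<Longrightarrow> length ks = m \<Longrightarrow> set ks \<subseteq> {..n} \<Longrightarrow>
      a \<odot>\<^bsub>EP m\<^esub> W (dxs ks) \<in> N"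
  assumes "p \<le> m" "ws \<in> tuples \<Omega> m" "length ds = m" "a \<in> gr j"
    and "\<And>l. l < p \<Longrightarrow> dspan (ds ! l) (ws ! l)"
    and "\<And>l. p \<le> l \<Longrightarrow> l < m \<Longrightarrow> \<exists>k\<le>n. ws ! l = d (x k)"
    and "j + (\<Sum>l<p. ds ! l - 1) = i - int m"
  shows "a \<odot>\<^bsub>EP m\<^esub> W ws \<in> N"
  using assms(3-)
proof (induction p arbitrary: ws a j)
  case 0
  have len: "length ws = m" using 0 by (simp add: tuples_def)
  have "\<forall>l. \<exists>k. l < m \<longrightarrow> k \<le> n \<and> ws ! l = d (x k)" using 0 by auto
  then obtain k where k: "\<And>l. l < m \<Longrightarrow> k l \<le> n \<and> ws ! l = d (x (k l))" by metis
  have "ws = dxs (map k [0..<m])"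
    by (rule nth_equalityI) (use len k in auto)
  moreover have "set (map k [0..<m]) \<subseteq> {..n}" using k by auto
  moreover have "a \<in> gr (i - int m)" using 0 by simp
  ultimately show ?case using gens[of a "map k [0..<m]"] by simp
next
  case (Suc p)
  interpret EP: module R "EP m" by (rule Om.ext_power_module)
  have p: "p < m" and a: "a \<in> carrier R" using Suc gr_closed by auto
  have len: "length ws = m" using Suc by (simp add: tuples_def)
  have "a \<odot>\<^bsub>EP m\<^esub> W (ws[p := w]) \<in> N" if "dspan (ds ! p) w" for w
    using that
  proof (induction rule: dspan.induct)
    case dspan_zero
    \<comment> \<open>A zero entry is 0 times itself, and the scalar 0 can be pulled out of the
      wedge.\<close>
    have "W (ws[p := \<zero> \<odot>\<^bsub>\<Omega>\<^esub> \<zero>\<^bsub>\<Omega>\<^esub>]) = \<zero> \<odot>\<^bsub>EP m\<^esub> W (ws[p := \<zero>\<^bsub>\<Omega>\<^esub>])"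
      by (rule Om.wedge_smult) (use Suc.prems p in auto)
    then have "W (ws[p := \<zero>\<^bsub>\<Omega>\<^esub>]) = \<zero>\<^bsub>EP m\<^esub>"
      using Om.wedge_closed[OF Om.tuples_update[OF Suc.prems(2), of "\<zero>\<^bsub>\<Omega>\<^esub>" p]] by simp
    then show ?case using N a by (simp add: LinearCombinations.submodule_def)
  next
    case (dspan_insert b k w)
    have b: "b \<in> carrier R" and dx: "d (x k) \<in> carrier \<Omega>" and w: "w \<in> carrier \<Omega>"
      using dspan_insert gr_closed dx_closed dspan_closed by auto
    note cl = Om.wedge_closed[OF Om.tuples_update[OF Suc.prems(2)]]
    have "W (ws[p := b \<odot>\<^bsub>\<Omega>\<^esub> d (x k) \<oplus>\<^bsub>\<Omega>\<^esub> w]) =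
        W (ws[p := b \<odot>\<^bsub>\<Omega>\<^esub> d (x k)]) \<oplus>\<^bsub>EP m\<^esub> W (ws[p := w])"
      by (rule Om.wedge_add) (use Suc.prems p b dx w in auto)
    also have "W (ws[p := b \<odot>\<^bsub>\<Omega>\<^esub> d (x k)]) = b \<odot>\<^bsub>EP m\<^esub> W (ws[p := d (x k)])"
      by (rule Om.wedge_smult) (use Suc.prems p b dx w in auto)
    finally have *: "a \<odot>\<^bsub>EP m\<^esub> W (ws[p := b \<odot>\<^bsub>\<Omega>\<^esub> d (x k) \<oplus>\<^bsub>\<Omega>\<^esub> w]) =
        (a \<otimes> b) \<odot>\<^bsub>EP m\<^esub> W (ws[p := d (x k)]) \<oplus>\<^bsub>EP m\<^esub> a \<odot>\<^bsub>EP m\<^esub> W (ws[p := w])"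
      using a b cl[OF dx] cl[OF w] by (simp add: EP.smult_r_distr EP.smult_assoc1)
    \<comment> \<open>The coefficient \<open>b\<close> has degree \<open>ds ! p - 1\<close> and
      joins \<open>a\<close>. This is exactly the summand by which the degree balance gets shorter,
      so the induction hypothesis applies.\<close>
    have "(a \<otimes> b) \<odot>\<^bsub>EP m\<^esub> W (ws[p := d (x k)]) \<in> N"
    proof (rule Suc.IH)
      show "a \<otimes> b \<in> gr (j + (ds ! p - 1))" by (rule gr_mult[OF Suc.prems(4) dspan_insert(1)])
      show "ws[p := d (x k)] \<in> tuples \<Omega> m" by (rule Om.tuples_update[OF Suc.prems(2) dx])
      show "dspan (ds ! l) (ws[p := d (x k)] ! l)" if "l < p" for l
        using Suc.prems(5)[of l] that by simp
      show "\<exists>k'\<le>n. ws[p := d (x k)] ! l = d (x k')" if "p \<le> l" "l < m" for l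
        using Suc.prems(6)[of l] that len dspan_insert(2) by (cases "l = p") auto
    qed (use Suc.prems in \<open>auto simp: algebra_simps\<close>)
    with dspan_insert(4) N show ?case unfolding * by (simp add: LinearCombinations.submodule_def)
  qed
  from this[OF Suc.prems(5)[of p]] show ?case by simp
qed

text \<open>The full expansion, started from the coefficient 1 of degree 0. It is applied to the
  zero space for \<open>m \<ge> 2\<close> and to the span of \<open>s\<close> forms for
  \<open>m = 1\<close>.\<close>

lemma ext_grading_subset:
  assumes N: "submodule class_ring N (EV m)"
    and gens: "\<And>a ks. a \<in> gr (i - int m) \<Longrightarrow> length ks = m \<Longrightarrow> set ks \<subseteq> {..n} \<Longrightarrow>
      a \<odot>\<^bsub>EP m\<^esub> W (dxs ks) \<in> N"
  shows "gr_E m i \<subseteq> N"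
proof -
  interpret V: vectorspace class_ring "EV m" by (rule EV_vectorspace)
  interpret EP: module R "EP m" by (rule Om.ext_power_module)
  have "W ws \<in> N"
    if ws: "length ws = m" "length ds = m" "\<And>l. l < m \<Longrightarrow> ws ! l \<in> gr_\<Omega> (ds ! l)" "sum_list ds = i"
    for ws ds
  proof -
    have tup: "ws \<in> tuples \<Omega> m"
      using ws kaehler_grading_dspan dspan_closed by (fastforce simp: tuples_def in_set_conv_nth)
    have "(\<Sum>l<m. ds ! l - 1) = i - int m"
      using ws(2,4) by (simp add: sum_subtractf sum_list_sum_nth atLeast0LessThan)
    then have "\<one> \<odot>\<^bsub>EP m\<^esub> W ws \<in> N"
      by (intro ext_grading_expand[OF N gens, where p = m and ds = ds and j = 0])
        (use ws tup gr_one kaehler_grading_dspan in auto)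
    then show ?thesis using Om.wedge_closed[OF tup] by simp
  qed
  then have "ext_gens m i \<subseteq> N" by (auto simp: ext_gens_def)
  then show ?thesis unfolding ext_grading_span by (rule V.span_is_subset[OF _ N])
qed

end

subsection \<open>Differential forms in large degrees\<close>

lemma regular_module_simps [simp]:
  "carrier (regular_module R) = carrier R"
  "\<zero>\<^bsub>regular_module R\<^esub> = \<zero>\<^bsub>R\<^esub>"
  "u \<oplus>\<^bsub>regular_module R\<^esub> v = u \<oplus>\<^bsub>R\<^esub> v"
  "c \<odot>\<^bsub>regular_module R\<^esub> v = c \<otimes>\<^bsub>R\<^esub> v"
  by (simp_all add: regular_module_def)

text \<open>Two polynomials that agree at all large integers differ by one with infinitely many
  roots, so the definite description is meaningful.\<close>

lemma hilbert_poly_eqI: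
  assumes "\<And>i. i \<ge> i0 \<Longrightarrow> of_nat (hilbert_fun V gr i) = poly p (of_int i)"
  shows "hilbert_poly V gr = p"
  unfolding hilbert_poly_def
proof (rule the_equality)
  show "\<exists>i0. \<forall>i\<ge>i0. of_nat (hilbert_fun V gr i) = poly p (of_int i)" using assms by blast
  fix q :: "rat poly" assume "\<exists>i1. \<forall>i\<ge>i1. of_nat (hilbert_fun V gr i) = poly q (of_int i)"
  then obtain i1 where i1: "\<And>i. i \<ge> i1 \<Longrightarrow> of_nat (hilbert_fun V gr i) = poly q (of_int i)" by blast
  have "rat_of_int ` {max i0 i1..} \<subseteq> {z. poly (q - p) z = 0}"
    using i1 assms by fastforce
  moreover have "infinite (rat_of_int ` {max i0 i1..})"
    by (subst finite_image_iff) (auto simp: inj_on_def infinite_Ici)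
  ultimately have "q - p = 0" using poly_roots_finite[of "q - p"] finite_subset by blast
  then show "q = p" by simp
qed

lemma (in vectorspace) dim_zero:
  assumes "carrier V = {\<zero>\<^bsub>V\<^esub>}"
  shows "dim = 0"
proof (rule dim0I)
  show "span {\<zero>\<^bsub>V\<^esub>} = carrier V"
    using in_own_span[of "{\<zero>\<^bsub>V\<^esub>}"] span_is_subset2[of "{\<zero>\<^bsub>V\<^esub>}"] assms by auto
qed

locale separated_points = points_algebra R \<phi> gr x n J ev D
  for R (structure) and \<phi> :: "'k::field \<Rightarrow> 'a" and gr x n and J :: "'p set" and ev D +
  fixes r :: int and f :: "'p \<Rightarrow> 'a"
  assumes f_gr: "q \<in> J \<Longrightarrow> f q \<in> gr r"
    and ev_f: "p \<in> J \<Longrightarrow> q \<in> J \<Longrightarrow> ev p (f q) = (if p = q then 1 else 0)"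
begin

text \<open>The square is what allows \<open>dx_k\<close> to be replaced by a multiple of
  \<open>dx_0\<close>; the power of \<open>x 0\<close> adjusts the degree without changing the
  values at the points.\<close>

definition h :: "nat \<Rightarrow> 'p \<Rightarrow> 'a" where
  "h e q = x 0 [^] e \<otimes> (f q \<otimes> f q)"

lemma x0_pow_gr: "x 0 [^] (e::nat) \<in> gr (int e)"
proof (induction e)
  case 0
  then show ?case using gr_one by simp
next
  case (Suc e)
  then show ?case using gr_mult[OF Suc x_gr[of 0]] by (simp add: algebra_simps)
qed

lemma ev_x0_pow: "q \<in> J \<Longrightarrow> ev q (x 0 [^] (e::nat)) = 1"
  by (induction e) (auto simp: ev_simps ev_x0 x_closed)

lemma f_closed: "q \<in> J \<Longrightarrow> f q \<in> carrier R"
  by (rule gr_closed[OF f_gr])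

lemma h_gr: "q \<in> J \<Longrightarrow> h e q \<in> gr (int e + 2 * r)"
  using gr_mult[OF x0_pow_gr gr_mult[OF f_gr f_gr], of q q e] by (simp add: h_def algebra_simps)

lemma h_closed: "q \<in> J \<Longrightarrow> h e q \<in> carrier R"
  by (rule gr_closed[OF h_gr])

lemma ev_h: "p \<in> J \<Longrightarrow> q \<in> J \<Longrightarrow> ev p (h e q) = (if p = q then 1 else 0)"
  by (simp add: h_def ev_simps ev_x0_pow f_closed x_closed ev_f)

text \<open>In degree \<open>i \<ge> 2r\<close> the element \<open>a\<close> equals the sum of the
  \<open>h (nat (i - 2 * r)) q\<close> with coefficients \<open>ev q a\<close>, since both have the
  same values at the points.\<close>

lemma separated_induct:
  assumes a: "a \<in> gr i" and i: "2 * r \<le> i" and zero: "P \<zero>"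
    and add: "\<And>b c. b \<in> gr i \<Longrightarrow> c \<in> gr i \<Longrightarrow> P b \<Longrightarrow> P c \<Longrightarrow> P (b \<oplus> c)"
    and h: "\<And>c q. q \<in> J \<Longrightarrow> P (\<phi> c \<otimes> h (nat (i - 2 * r)) q)"
  shows "P a"
proof -
  \<comment> \<open>Partial sums over \<open>J'\<close>: they agree with \<open>a\<close> on
    \<open>J'\<close> and vanish at the remaining points.\<close>
  have "\<exists>b\<in>gr i. P b \<and> (\<forall>p\<in>J. ev p b = (if p \<in> J' then ev p a else 0))"
    if "J' \<subseteq> J" for J'
    using finite_subset[OF that finite_points] that
  proof (induction J' rule: finite_induct)
    case empty
    then show ?case using zero gr_zero ev_simps(4) by auto
  next
    case (insert q J')
    then obtain b where b: "b \<in> gr i" "P b" "\<And>p. p \<in> J \<Longrightarrow> ev p b = (if p \<in> J' then ev p a else 0)"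
      by auto
    have q: "q \<in> J" using insert by auto
    let ?t = "\<phi> (ev q a) \<otimes> h (nat (i - 2 * r)) q"
    have t: "?t \<in> gr i" using gr_smult[OF h_gr[OF q, of "nat (i - 2 * r)"]] i by simp
    show ?case
    proof (intro bexI[of _ "b \<oplus> ?t"] conjI ballI)
      show "P (b \<oplus> ?t)" by (rule add[OF b(1) t b(2) h[OF q]])
      show "ev p (b \<oplus> ?t) = (if p \<in> insert q J' then ev p a else 0)" if "p \<in> J" for p
        using that q insert.hyps(2) gr_closed[OF b(1)] gr_closed[OF t] h_closed[OF q]
        by (simp add: ev_simps[OF that] b(3) ev_const[OF that] const_simps(1) ev_h)
      show "b \<oplus> ?t \<in> gr i" by (rule gr_add[OF b(1) t])
    qed
  qed
  from this[of J] obtain b where "b \<in> gr i" "P b" "\<And>p. p \<in> J \<Longrightarrow> ev p b = ev p a" by auto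
  then show ?thesis using ev_eqI[OF _ a] by metis
qed

text \<open>Differentiate \<open>f x\<^sub>k = p\<^sub>k x\<^sub>0 f\<close>, where \<open>p\<^sub>k\<close> is the \<open>k\<close>-th coordinate of the point, and multiply
  by \<open>f\<close>: the terms in \<open>df\<close> cancel.\<close>

lemma f_sq_dx:
  assumes q: "q \<in> J" and k: "k \<le> n"
  shows "(f q \<otimes> f q) \<odot>\<^bsub>\<Omega>\<^esub> d (x k) = (\<phi> (ev q (x k)) \<otimes> (f q \<otimes> f q)) \<odot>\<^bsub>\<Omega>\<^esub> d (x 0)"
proof -
  let ?F = "f q" and ?c = "\<phi> (ev q (x k))"
  have F: "?F \<in> carrier R" and c: "?c \<in> carrier R" and xk: "x k \<in> carrier R" and x0: "x 0 \<in> carrier R"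
    using f_closed[OF q] const_simps(1) x_closed[OF k] x_closed[of 0] by auto
  note dc = d_closed[OF F] d_closed[OF xk] d_closed[OF x0]
  \<comment> \<open>At the point \<open>q\<close> both sides take the value of \<open>x k\<close>,
    as \<open>x 0\<close> is 1 there; at every other point the separator vanishes.\<close>
  have eq: "?F \<otimes> x k = ?c \<otimes> (?F \<otimes> x 0)"
  proof (rule ev_eqI)
    show "?F \<otimes> x k \<in> gr (r + 1)" by (rule gr_mult[OF f_gr[OF q] x_gr[OF k]])
    show "?c \<otimes> (?F \<otimes> x 0) \<in> gr (r + 1)"
      by (rule gr_smult[OF gr_mult[OF f_gr[OF q] x_gr]]) simp
    show "ev p (?F \<otimes> x k) = ev p (?c \<otimes> (?F \<otimes> x 0))" if p: "p \<in> J" for p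
      using F c xk x0 by (auto simp: ev_simps[OF p] ev_f[OF p q] ev_x0[OF p] ev_const[OF p])
  qed
  have "?F \<odot>\<^bsub>\<Omega>\<^esub> d (x k) \<oplus>\<^bsub>\<Omega>\<^esub> x k \<odot>\<^bsub>\<Omega>\<^esub> d ?F = d (?F \<otimes> x k)"
    by (rule d_mult[OF F xk, symmetric])
  also have "\<dots> = ?c \<odot>\<^bsub>\<Omega>\<^esub> d (?F \<otimes> x 0) \<oplus>\<^bsub>\<Omega>\<^esub> (?F \<otimes> x 0) \<odot>\<^bsub>\<Omega>\<^esub> d ?c"
    unfolding eq by (rule d_mult) (use F c x0 in auto)
  also have "\<dots> = ?c \<odot>\<^bsub>\<Omega>\<^esub> (?F \<odot>\<^bsub>\<Omega>\<^esub> d (x 0) \<oplus>\<^bsub>\<Omega>\<^esub> x 0 \<odot>\<^bsub>\<Omega>\<^esub> d ?F)"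
    using F c x0 dc by (simp add: d_const d_mult)
  finally have "?F \<odot>\<^bsub>\<Omega>\<^esub> (?F \<odot>\<^bsub>\<Omega>\<^esub> d (x k) \<oplus>\<^bsub>\<Omega>\<^esub> x k \<odot>\<^bsub>\<Omega>\<^esub> d ?F) =
      ?F \<odot>\<^bsub>\<Omega>\<^esub> (?c \<odot>\<^bsub>\<Omega>\<^esub> (?F \<odot>\<^bsub>\<Omega>\<^esub> d (x 0) \<oplus>\<^bsub>\<Omega>\<^esub> x 0 \<odot>\<^bsub>\<Omega>\<^esub> d ?F))" by simp
  moreover have "?F \<odot>\<^bsub>\<Omega>\<^esub> (?F \<odot>\<^bsub>\<Omega>\<^esub> d (x k) \<oplus>\<^bsub>\<Omega>\<^esub> x k \<odot>\<^bsub>\<Omega>\<^esub> d ?F) =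
      (?F \<otimes> ?F) \<odot>\<^bsub>\<Omega>\<^esub> d (x k) \<oplus>\<^bsub>\<Omega>\<^esub> (?F \<otimes> x k) \<odot>\<^bsub>\<Omega>\<^esub> d ?F"
    using F xk dc by (simp add: Om.smult_r_distr Om.smult_assoc1)
  moreover have "?F \<odot>\<^bsub>\<Omega>\<^esub> (?c \<odot>\<^bsub>\<Omega>\<^esub> (?F \<odot>\<^bsub>\<Omega>\<^esub> d (x 0) \<oplus>\<^bsub>\<Omega>\<^esub> x 0 \<odot>\<^bsub>\<Omega>\<^esub> d ?F)) =
      (?F \<otimes> (?c \<otimes> ?F)) \<odot>\<^bsub>\<Omega>\<^esub> d (x 0) \<oplus>\<^bsub>\<Omega>\<^esub> (?F \<otimes> (?c \<otimes> x 0)) \<odot>\<^bsub>\<Omega>\<^esub> d ?F"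
    using F c x0 dc by (simp add: Om.smult_r_distr Om.smult_assoc1)
  \<comment> \<open>The second identity is \<open>eq\<close> again: after the multiplication by the
    separator, its differential has the same coefficient on both sides.\<close>
  moreover have "?F \<otimes> (?c \<otimes> ?F) = ?c \<otimes> (?F \<otimes> ?F)" "?F \<otimes> (?c \<otimes> x 0) = ?F \<otimes> x k"
    unfolding eq by (rule m_lcomm; use F c x0 in simp)+
  ultimately have "(?F \<otimes> ?F) \<odot>\<^bsub>\<Omega>\<^esub> d (x k) \<oplus>\<^bsub>\<Omega>\<^esub> (?F \<otimes> x k) \<odot>\<^bsub>\<Omega>\<^esub> d ?F =
      (?c \<otimes> (?F \<otimes> ?F)) \<odot>\<^bsub>\<Omega>\<^esub> d (x 0) \<oplus>\<^bsub>\<Omega>\<^esub> (?F \<otimes> x k) \<odot>\<^bsub>\<Omega>\<^esub> d ?F" by simp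
  then show ?thesis
    by (subst (asm) Om.M.add.right_cancel) (use F c xk dc in auto)
qed

lemma h_dx:
  assumes q: "q \<in> J" and k: "k \<le> n"
  shows "h e q \<odot>\<^bsub>\<Omega>\<^esub> d (x k) = (\<phi> (ev q (x k)) \<otimes> h e q) \<odot>\<^bsub>\<Omega>\<^esub> d (x 0)"
proof -
  have F: "f q \<otimes> f q \<in> carrier R" and c: "\<phi> (ev q (x k)) \<in> carrier R"
    and X: "x 0 [^] e \<in> carrier R"
    using f_closed[OF q] const_simps(1) x_closed[of 0] by auto
  note dc = dx_closed[OF k] dx_closed[of 0]
  have "h e q \<odot>\<^bsub>\<Omega>\<^esub> d (x k) = x 0 [^] e \<odot>\<^bsub>\<Omega>\<^esub> ((f q \<otimes> f q) \<odot>\<^bsub>\<Omega>\<^esub> d (x k))"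
    unfolding h_def by (rule Om.smult_assoc1[OF X F dc(1)])
  also have "\<dots> = (x 0 [^] e \<otimes> (\<phi> (ev q (x k)) \<otimes> (f q \<otimes> f q))) \<odot>\<^bsub>\<Omega>\<^esub> d (x 0)"
    unfolding f_sq_dx[OF q k] by (rule Om.smult_assoc1[symmetric]) (use F X c dc in auto)
  also have "x 0 [^] e \<otimes> (\<phi> (ev q (x k)) \<otimes> (f q \<otimes> f q)) = \<phi> (ev q (x k)) \<otimes> h e q"
    unfolding h_def by (rule m_lcomm[OF X c F])
  finally show ?thesis .
qed

text \<open>The factor moves into slot \<open>l\<close>, is used there by \<open>h_dx\<close>, and
  comes out again unchanged up to a constant; so it is available for the next slot.\<close>

lemma h_wedge:
  assumes q: "q \<in> J" and k: "k \<le> n" and ws: "ws \<in> tuples \<Omega> m" and l: "l < m" "ws ! l = d (x k)"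
  shows "h e q \<odot>\<^bsub>EP m\<^esub> W ws = (\<phi> (ev q (x k)) \<otimes> h e q) \<odot>\<^bsub>EP m\<^esub> W (ws[l := d (x 0)])"
proof -
  have "ws = ws[l := d (x k)]" using l(2) by (metis list_update_id)
  then have "h e q \<odot>\<^bsub>EP m\<^esub> W ws = h e q \<odot>\<^bsub>EP m\<^esub> W (ws[l := d (x k)])" by simp
  also have "\<dots> = W (ws[l := h e q \<odot>\<^bsub>\<Omega>\<^esub> d (x k)])"
    by (rule Om.wedge_smult[OF ws l(1) h_closed[OF q] dx_closed[OF k], symmetric])
  also have "\<dots> = (\<phi> (ev q (x k)) \<otimes> h e q) \<odot>\<^bsub>EP m\<^esub> W (ws[l := d (x 0)])"
    unfolding h_dx[OF q k]
    by (rule Om.wedge_smult[OF ws l(1)]) (use h_closed[OF q] const_simps(1) dx_closed in auto)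
  finally show ?thesis .
qed

text \<open>By \<open>separated_induct\<close> the coefficient may be taken to be
  \<open>h e q\<close>. Two applications of \<open>h_wedge\<close> put \<open>d (x 0)\<close> into
  slots 0 and 1, and the repeated entry kills the product.\<close>

lemma wedge_dxs_zero:
  assumes "a \<in> gr i" "2 * r \<le> i" "2 \<le> m" "length ks = m" "set ks \<subseteq> {..n}"
  shows "a \<odot>\<^bsub>EP m\<^esub> W (dxs ks) = \<zero>\<^bsub>EP m\<^esub>"
proof -
  interpret EP: module R "EP m" by (rule Om.ext_power_module)
  let ?ws = "dxs ks"
  have tup: "?ws \<in> tuples \<Omega> m" by (rule dxs_tuples[OF assms(4,5)])
  note Wc = Om.wedge_closed[OF tup]
  have h: "h e q \<odot>\<^bsub>EP m\<^esub> W ?ws = \<zero>\<^bsub>EP m\<^esub>" if q: "q \<in> J" for e q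
  proof -
    let ?w1 = "?ws[0 := d (x 0)]" and ?w2 = "?ws[0 := d (x 0), 1 := d (x 0)]"
    let ?c = "\<lambda>l. \<phi> (ev q (x (ks ! l)))"
    have kn: "ks ! l \<le> n" if "l < m" for l using assms(4,5) that nth_mem by blast
    have t1: "?w1 \<in> tuples \<Omega> m" by (intro Om.tuples_update[OF tup] dx_closed) simp
    have t2: "?w2 \<in> tuples \<Omega> m" by (intro Om.tuples_update[OF t1] dx_closed) simp
    note cl = const_simps(1) h_closed[OF q] Om.wedge_closed[OF t1] Om.wedge_closed[OF t2]
    have "h e q \<odot>\<^bsub>EP m\<^esub> W ?ws = (?c 0 \<otimes> h e q) \<odot>\<^bsub>EP m\<^esub> W ?w1"
      by (rule h_wedge[OF q kn tup]) (use assms in auto)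
    also have "\<dots> = ?c 0 \<odot>\<^bsub>EP m\<^esub> (h e q \<odot>\<^bsub>EP m\<^esub> W ?w1)"
      by (rule EP.smult_assoc1[OF cl(1-3)])
    also have "h e q \<odot>\<^bsub>EP m\<^esub> W ?w1 = (?c 1 \<otimes> h e q) \<odot>\<^bsub>EP m\<^esub> W ?w2"
      by (rule h_wedge[OF q kn t1]) (use assms in auto)
    also have "W ?w2 = \<zero>\<^bsub>EP m\<^esub>"
      by (rule Om.wedge_eq_entries[OF t2, of 0 1]) (use assms in auto)
    finally show ?thesis using cl by simp
  qed
  show ?thesis
  proof (rule separated_induct[OF assms(1,2), of "\<lambda>a. a \<odot>\<^bsub>EP m\<^esub> W ?ws = \<zero>\<^bsub>EP m\<^esub>"])
    show "(\<phi> c \<otimes> h (nat (i - 2 * r)) q) \<odot>\<^bsub>EP m\<^esub> W ?ws = \<zero>\<^bsub>EP m\<^esub>" if "q \<in> J" for c q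
      using Wc h[OF that] h_closed[OF that] const_simps(1) by (simp add: EP.smult_assoc1)
  qed (use Wc gr_closed in \<open>auto simp: EP.smult_l_distr\<close>)
qed

lemma EV_piece_vectorspace: "vectorspace class_ring (EV m\<lparr>carrier := gr_E m i\<rparr>)"
  by (rule vectorspace.subspace_is_vs[OF EV_vectorspace
        subspace.intro[OF EV_vectorspace ext_grading_submodule]])

lemma hilbert_fun_forms_ge_2:
  assumes "2 \<le> m" "2 * r + int m \<le> i"
  shows "hilbert_fun (EV m) (gr_E m) i = 0"
proof -
  interpret V: vectorspace class_ring "EV m" by (rule EV_vectorspace)
  interpret EP: module R "EP m" by (rule Om.ext_power_module)
  have "submodule class_ring {\<zero>\<^bsub>EV m\<^esub>} (EV m)"
    using V.module_axioms by (simp add: LinearCombinations.submodule_def const_simps(1))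
  then have "gr_E m i \<subseteq> {\<zero>\<^bsub>EV m\<^esub>}"
  proof (rule ext_grading_subset)
    show "a \<odot>\<^bsub>EP m\<^esub> W (dxs ks) \<in> {\<zero>\<^bsub>EV m\<^esub>}"
      if "a \<in> gr (i - int m)" "length ks = m" "set ks \<subseteq> {..n}" for a ks
      \<comment> \<open>The coefficient has degree \<open>i - m\<close>, which is at least
        \<open>2r\<close> by the assumed bound.\<close>
      using wedge_dxs_zero[OF that(1) _ assms(1) that(2,3)] assms(2) by simp
  qed
  then have "gr_E m i = {\<zero>\<^bsub>EV m\<^esub>}"
    using ext_grading_submodule[of m i] by (auto simp: LinearCombinations.submodule_def)
  then show ?thesis unfolding hilbert_fun_def
    by (intro vectorspace.dim_zero[OF EV_piece_vectorspace]) simp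
qed

lemma hilbert_fun_forms_1:
  assumes "2 * r + 1 \<le> i"
  shows "hilbert_fun (EV 1) (gr_E 1) i = card J"
proof -
  note One_nat_def [simp del]
  interpret V: vectorspace class_ring "EV 1" by (rule EV_vectorspace)
  interpret EP: module R "EP 1" by (rule Om.ext_power_module)
  \<comment> \<open>Chosen so that \<open>h e q\<close> has degree \<open>i - 1\<close> and its
    product with \<open>d (x 0)\<close> degree \<open>i\<close>; the bound on \<open>i\<close> keeps
    \<open>nat\<close> from truncating.\<close>
  define e where "e = nat (i - 1 - 2 * r)"
  have e: "int e + 2 * r = i - 1" using assms by (simp add: e_def)
  define g where "g q = W [h e q \<odot>\<^bsub>\<Omega>\<^esub> d (x 0)]" for q
  have hdx: "h e q \<odot>\<^bsub>\<Omega>\<^esub> d (x 0) \<in> carrier \<Omega>" if "q \<in> J" for q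
    using h_closed[OF that] dx_closed[of 0] by simp
  have tup: "[w] \<in> tuples \<Omega> 1" if "w \<in> carrier \<Omega>" for w using that by (simp add: tuples_def)
  have W_smult: "W [a \<odot>\<^bsub>\<Omega>\<^esub> w] = a \<odot>\<^bsub>EP 1\<^esub> W [w]" if "a \<in> carrier R" "w \<in> carrier \<Omega>" for a w
    using Om.wedge_smult[OF tup[OF that(2)], of 0 a w] that by simp
  have gc: "g ` J \<subseteq> carrier (EV 1)"
    using hdx tup Om.wedge_closed by (auto simp: g_def)
  have g_gr: "g q \<in> gr_E 1 i" if "q \<in> J" for q
  proof -
    have "h e q \<odot>\<^bsub>\<Omega>\<^esub> d (x 0) \<in> gr_\<Omega> i"
      by (rule kaehler_grading_dx) (use h_gr[OF that, of e] e in auto)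
    then have "g q \<in> ext_gens 1 i"
      unfolding ext_gens_def g_def
      by (intro CollectI exI[of _ "[h e q \<odot>\<^bsub>\<Omega>\<^esub> d (x 0)]"] exI[of _ "[i]"]) auto
    then show ?thesis
      unfolding ext_grading_span using V.in_own_span[OF ext_gens_closed] by blast
  qed
  have sub: "submodule class_ring (V.span (g ` J)) (EV 1)" by (rule V.span_is_submodule[OF gc])
  \<comment> \<open>Spanning: the coefficient of \<open>d (x k)\<close> is reduced to multiples of
    \<open>h e q\<close>, for which \<open>h_dx\<close> replaces \<open>d (x k)\<close> by a
    constant times \<open>d (x 0)\<close>.\<close>
  have "gr_E 1 i \<subseteq> V.span (g ` J)"
  proof (rule ext_grading_subset[OF sub])
    fix a and ks :: "nat list"
    assume a: "a \<in> gr (i - int 1)" and ks: "length ks = 1" "set ks \<subseteq> {..n}"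
    from ks obtain k where k: "ks = [k]" "k \<le> n" by (cases ks) auto
    note Wc = Om.wedge_closed[OF tup[OF dx_closed[OF k(2)]]]
    have "a \<odot>\<^bsub>EP 1\<^esub> W [d (x k)] \<in> V.span (g ` J)"
    proof (rule separated_induct[OF a, of "\<lambda>a. a \<odot>\<^bsub>EP 1\<^esub> W [d (x k)] \<in> V.span (g ` J)"])
      show "2 * r \<le> i - int 1" using assms by simp
      show "\<zero> \<odot>\<^bsub>EP 1\<^esub> W [d (x k)] \<in> V.span (g ` J)"
        using Wc sub by (simp add: LinearCombinations.submodule_def)
      show "(b \<oplus> c) \<odot>\<^bsub>EP 1\<^esub> W [d (x k)] \<in> V.span (g ` J)"
        if "b \<in> gr (i - int 1)" "c \<in> gr (i - int 1)"
          "b \<odot>\<^bsub>EP 1\<^esub> W [d (x k)] \<in> V.span (g ` J)" "c \<odot>\<^bsub>EP 1\<^esub> W [d (x k)] \<in> V.span (g ` J)" for b c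
        using EP.smult_l_distr[OF gr_closed[OF that(1)] gr_closed[OF that(2)] Wc] that(3,4) sub
        by (simp add: LinearCombinations.submodule_def)
      show "(\<phi> c \<otimes> h (nat (i - int 1 - 2 * r)) q) \<odot>\<^bsub>EP 1\<^esub> W [d (x k)] \<in> V.span (g ` J)"
        if q: "q \<in> J" for c q
      proof -
        have hc: "h e q \<in> carrier R" by (rule h_closed[OF q])
        have "h e q \<odot>\<^bsub>EP 1\<^esub> W [d (x k)] = W [h e q \<odot>\<^bsub>\<Omega>\<^esub> d (x k)]"
          by (rule W_smult[OF hc dx_closed[OF k(2)], symmetric])
        also have "\<dots> = W [\<phi> (ev q (x k)) \<odot>\<^bsub>\<Omega>\<^esub> (h e q \<odot>\<^bsub>\<Omega>\<^esub> d (x 0))]"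
          unfolding h_dx[OF q k(2)] using Om.smult_assoc1[OF const_simps(1) hc dx_closed[of 0]] by simp
        also have "\<dots> = \<phi> (ev q (x k)) \<odot>\<^bsub>EP 1\<^esub> g q"
          unfolding g_def by (rule W_smult[OF const_simps(1) hdx[OF q]])
        finally have "(\<phi> c \<otimes> h e q) \<odot>\<^bsub>EP 1\<^esub> W [d (x k)] = \<phi> c \<odot>\<^bsub>EP 1\<^esub> (\<phi> (ev q (x k)) \<odot>\<^bsub>EP 1\<^esub> g q)"
          using EP.smult_assoc1[OF const_simps(1) hc Wc] by simp
        moreover have "g q \<in> V.span (g ` J)" using V.in_own_span[OF gc] q by auto
        ultimately show ?thesis
          using sub by (simp add: LinearCombinations.submodule_def e_def)
      qed
    qed
    then show "a \<odot>\<^bsub>EP 1\<^esub> W (dxs ks) \<in> V.span (g ` J)" using k by simp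
  qed
  \<comment> \<open>The dimension is taken in the graded piece as a space of its own, so the span
    has to be transferred to it from the ambient space.\<close>
  moreover have "LinearCombinations.module.span class_ring (EV 1\<lparr>carrier := gr_E 1 i\<rparr>) (g ` J) = V.span (g ` J)"
    by (rule V.span_li_not_depend(1)[OF _ ext_grading_submodule]) (use g_gr in auto)
  ultimately have span: "carrier (EV 1\<lparr>carrier := gr_E 1 i\<rparr>) \<subseteq>
      LinearCombinations.module.span class_ring (EV 1\<lparr>carrier := gr_E 1 i\<rparr>) (g ` J)" by simp
  \<comment> \<open>Independence: the derivation \<open>D q\<close> gives a functional on the
    differentials, then on their first exterior power. It sends \<open>g p\<close> to
    \<open>ev q (h e p) * D q (x 0)\<close>, and the second factor is 1.\<close>
  have "\<exists>L. functional R (ev q) (EP 1) L \<and> (\<forall>p\<in>J. L (g p) = (if q = p then 1 else 0))"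
    if q: "q \<in> J" for q
  proof -
    obtain L where L: "functional R (ev q) \<Omega> L" "\<And>a. a \<in> carrier R \<Longrightarrow> L (d a) = D q a"
      by (rule functional_kaehler[OF ev_hom[OF q], of "D q"])
        (use D_add[OF q] D_mult[OF q] D_const[OF q] that in auto)
    obtain L' where L': "functional R (ev q) (EP 1) L'" "\<And>w. w \<in> carrier \<Omega> \<Longrightarrow> L' (W [w]) = L w"
      by (rule Om.functional_ext_power_1[OF ev_hom[OF q] L(1)]) (rule that)
    have "L' (g p) = (if q = p then 1 else 0)" if p: "p \<in> J" for p
    proof -
      have "L' (g p) = ev q (h e p) * L (d (x 0))"
        unfolding g_def L'(2)[OF hdx[OF p]]
        by (rule functional_smult[OF L(1) h_closed[OF p] dx_closed]) simp
      also have "L (d (x 0)) = 1" using L(2)[OF x_closed[of 0]] D_x0[OF q] by simp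
      finally show ?thesis using ev_h[OF q p] by simp
    qed
    then show ?thesis using L'(1) by blast
  qed
  then obtain L where L: "\<And>q. q \<in> J \<Longrightarrow> functional R (ev q) (EP 1) (L q)"
      "\<And>q p. q \<in> J \<Longrightarrow> p \<in> J \<Longrightarrow> L q (g p) = (if q = p then 1 else 0)"
    by metis
  have gr_c: "gr_E 1 i \<subseteq> carrier (EP 1)"
    using ext_grading_submodule[of 1 i] by (simp add: LinearCombinations.submodule_def)
  show ?thesis unfolding hilbert_fun_def
  proof (rule dim_eq_card_dual[OF EV_piece_vectorspace finite_points _ _ L(2) span])
    show "g q \<in> carrier (EV 1\<lparr>carrier := gr_E 1 i\<rparr>)" if "q \<in> J" for q using g_gr[OF that] by simp
    \<comment> \<open>Linearity over the ring through \<open>ev q\<close> restricts to linearity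
      over \<open>K\<close>, because \<open>ev q\<close> returns \<open>c\<close> at the constant
      \<open>\<phi> c\<close>.\<close>
    show "functional class_ring (\<lambda>c. c) (EV 1\<lparr>carrier := gr_E 1 i\<rparr>) (L q)" if "q \<in> J" for q
      unfolding functional_def
      using functional_add[OF L(1)[OF that]] functional_smult[OF L(1)[OF that] const_simps(1)]
        ev_const[OF that] gr_c by (simp add: subset_iff)
  qed
qed

end

subsection \<open>Hilbert polynomials and regularity indices\<close>

context points_algebra
begin

definition separated :: "int \<Rightarrow> bool" where
  "separated i \<longleftrightarrow> (\<exists>f. (\<forall>q\<in>J. f q \<in> gr i) \<and> (\<forall>p\<in>J. \<forall>q\<in>J. ev p (f q) = (if p = q then 1 else 0)))"

abbreviation RV where "RV \<equiv> restrict_scalars \<phi> (regular_module R)"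

lemma RV_vectorspace: "vectorspace class_ring RV"
  by (rule restrict_scalars_vectorspace[OF regular_module_module[OF is_cring] const_hom])

lemma gr_submodule: "submodule class_ring (gr i) RV"
proof -
  interpret V: vectorspace class_ring RV by (rule RV_vectorspace)
  show ?thesis
    using V.module_axioms gr_closed gr_zero gr_add gr_smult
    by (auto simp: LinearCombinations.submodule_def)
qed

text \<open>The evaluations are jointly injective on each piece, so by
  \<open>dim_eq_card_iff_dual\<close> full dimension means that a family dual to them
  exists.\<close>

lemma hilbert_fun_ring: "hilbert_fun RV gr i = card J \<longleftrightarrow> separated i"
proof -
  have V: "vectorspace class_ring (RV\<lparr>carrier := gr i\<rparr>)"
    by (rule vectorspace.subspace_is_vs[OF RV_vectorspace
          subspace.intro[OF RV_vectorspace gr_submodule]])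
  have L: "functional class_ring (\<lambda>c. c) (RV\<lparr>carrier := gr i\<rparr>) (ev q)" if q: "q \<in> J" for q
    using ev_simps(1,2)[OF q] ev_const[OF q] gr_closed const_simps(1) by (simp add: functional_def)
  show ?thesis
    unfolding hilbert_fun_def separated_def
    using dim_eq_card_iff_dual[OF V finite_points L] ev_separates[of _ i] by simp
qed

text \<open>Multiplication by \<open>x 0\<close> raises the degree and leaves all values at the
  points unchanged.\<close>

lemma separated_Suc:
  assumes "separated i"
  shows "separated (i + 1)"
proof -
  obtain f where f: "\<And>q. q \<in> J \<Longrightarrow> f q \<in> gr i"
      "\<And>p q. p \<in> J \<Longrightarrow> q \<in> J \<Longrightarrow> ev p (f q) = (if p = q then 1 else 0)"
    using assms unfolding separated_def by blast
  show ?thesis unfolding separated_def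
  proof (intro exI[of _ "\<lambda>q. f q \<otimes> x 0"] conjI ballI)
    show "f q \<otimes> x 0 \<in> gr (i + 1)" if "q \<in> J" for q
      by (rule gr_mult[OF f(1)[OF that] x_gr]) simp
    show "ev p (f q \<otimes> x 0) = (if p = q then 1 else 0)" if "p \<in> J" "q \<in> J" for p q
      using ev_simps(2)[OF that(1) gr_closed[OF f(1)[OF that(2)]] x_closed[of 0]]
        ev_x0[OF that(1)] f(2)[OF that] by simp
  qed
qed

lemma separated_mono: "separated i \<Longrightarrow> i \<le> j \<Longrightarrow> separated j"
  by (rotate_tac, induction j rule: int_ge_induct) (auto intro: separated_Suc)

text \<open>A product of linear forms \<open>x\<^sub>k - p\<^sub>k x\<^sub>0\<close>, each of which vanishes at a point \<open>p \<in> J'\<close> but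
  not at \<open>q\<close>, normalised to the value \<open>1\<close> at \<open>q\<close>.\<close>

lemma separating_form:
  assumes "finite J'" "J' \<subseteq> J - {q}" "q \<in> J"
  shows "\<exists>f\<in>gr (int (card J')). ev q f = 1 \<and> (\<forall>p\<in>J'. ev p f = 0)"
  using assms(1,2)
proof (induction J' rule: finite_induct)
  case empty
  then show ?case using gr_one ev_simps(3)[OF assms(3)] by auto
next
  case (insert p J')
  then obtain f where f: "f \<in> gr (int (card J'))" "ev q f = 1" "\<And>p. p \<in> J' \<Longrightarrow> ev p f = 0"
    by auto
  have p: "p \<in> J" "p \<noteq> q" using insert.prems by auto
  obtain k where k: "k \<le> n" "ev p (x k) \<noteq> ev q (x k)"
    using x_separates[OF p(1) assms(3) p(2)] by blast
  let ?c = "inverse (ev q (x k) - ev p (x k))"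
  let ?l = "\<phi> ?c \<otimes> (x k \<oplus> \<phi> (- ev p (x k)) \<otimes> x 0)"
  have l: "?l \<in> gr 1"
    by (intro gr_smult gr_add x_gr k) simp
  have lc: "?l \<in> carrier R" by (rule gr_closed[OF l])
  have ev_l: "ev p' ?l = ?c * (ev p' (x k) - ev p (x k))" if "p' \<in> J" for p'
    using x_closed[OF k(1)] x_closed[of 0] const_simps(1)
    by (simp add: ev_simps(1,2)[OF that] ev_const[OF that] ev_x0[OF that])
  show ?case
  proof (intro bexI[of _ "f \<otimes> ?l"] conjI ballI)
    show "ev q (f \<otimes> ?l) = 1"
      unfolding ev_simps(2)[OF assms(3) gr_closed[OF f(1)] lc] ev_l[OF assms(3)] f(2)
      using k(2) by simp
    show "ev p' (f \<otimes> ?l) = 0" if "p' \<in> insert p J'" for p'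
    proof -
      have p': "p' \<in> J" using that insert.prems by auto
      show ?thesis
        unfolding ev_simps(2)[OF p' gr_closed[OF f(1)] lc] ev_l[OF p'] using that f(3) by auto
    qed
    show "f \<otimes> ?l \<in> gr (int (card (insert p J')))"
      using gr_mult[OF f(1) l] insert.hyps by (simp add: add.commute)
  qed
qed

text \<open>Each of the other points contributes one linear form to the separator of
  \<open>q\<close>, hence the degree \<open>card J - 1\<close>. Without points this degree is -1 and
  the claim is vacuous.\<close>

lemma separated_exists: "\<exists>i. separated i"
proof -
  have "\<exists>f\<in>gr (int (card J) - 1). ev q f = 1 \<and> (\<forall>p\<in>J - {q}. ev p f = 0)" if "q \<in> J" for q
  proof -
    have "int (card (J - {q})) = int (card J) - 1"
      using that finite_points by (metis card_Suc_Diff1 of_nat_Suc add_diff_cancel_left')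
    then show ?thesis using separating_form[of "J - {q}" q] that finite_points by auto
  qed
  then obtain f where "\<And>q. q \<in> J \<Longrightarrow> f q \<in> gr (int (card J) - 1) \<and> ev q (f q) = 1 \<and>
      (\<forall>p\<in>J - {q}. ev p (f q) = 0)"
    by metis
  then have "separated (int (card J) - 1)"
    unfolding separated_def by (intro exI[of _ f]) auto
  then show ?thesis by blast
qed

lemma hilbert_poly_ring: "hilbert_poly RV gr = [:of_nat (card J):]"
proof -
  obtain i0 where "separated i0" using separated_exists by blast
  then show ?thesis
    using hilbert_fun_ring separated_mono by (intro hilbert_poly_eqI[of i0]) auto
qed

lemma hilbert_fun_forms:
  assumes "separated r" "1 \<le> m" "2 * r + int m \<le> i"
  shows "hilbert_fun (EV m) (gr_E m) i = (if m = 1 then card J else 0)"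
proof -
  obtain f where f: "\<And>q. q \<in> J \<Longrightarrow> f q \<in> gr r"
      "\<And>p q. p \<in> J \<Longrightarrow> q \<in> J \<Longrightarrow> ev p (f q) = (if p = q then 1 else 0)"
    using assms(1) unfolding separated_def by blast
  interpret separated_points R \<phi> gr x n J ev D r f
    by (rule separated_points.intro[OF points_algebra_axioms separated_points_axioms.intro])
      (rule f; assumption)+
  show ?thesis
  proof (cases "m = 1")
    case True
    then show ?thesis using hilbert_fun_forms_1[of i] assms(3) by simp
  next
    case False
    then show ?thesis using hilbert_fun_forms_ge_2[of m i] assms(2,3) by simp
  qed
qed

text \<open>If separators exist in degree \<open>r\<close>, the Hilbert function of the forms has
  its final value from \<open>2r + m\<close> on. Every index admissible for the ring is such a
  degree \<open>r\<close>, and passing to the infimum of these indices gives the bound.\<close>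

theorem hilbert_poly_and_reg_index_forms:
  assumes m: "1 \<le> m"
  shows "hilbert_poly (EV m) (gr_E m) = (if m = 1 then [:of_nat (card J):] else 0)" (is "?H = ?p")
    and "reg_index (EV m) (gr_E m) \<le> 2 * reg_index RV gr + ereal (real m)"
proof -
  have HF: "of_nat (hilbert_fun (EV m) (gr_E m) j) = poly ?p (of_int j)"
    if "separated r" "2 * r + int m \<le> j" for r j
    using hilbert_fun_forms[OF that(1) m that(2)] by simp
  obtain i0 where "separated i0" using separated_exists by blast
  then show H: "?H = ?p" using HF by (intro hilbert_poly_eqI[of "2 * i0 + int m"]) auto
  define A where "A = {i. \<forall>j\<ge>i. of_nat (hilbert_fun RV gr j) = poly (hilbert_poly RV gr) (of_int j)}"
  have A: "separated i" if "i \<in> A" for i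
  proof -
    have "of_nat (hilbert_fun RV gr i) = (of_nat (card J) :: rat)"
      using that by (auto simp: A_def hilbert_poly_ring)
    then show ?thesis using hilbert_fun_ring by simp
  qed
  have bound: "reg_index (EV m) (gr_E m) \<le> ereal (2 * real_of_int i + real m)" if "i \<in> A" for i
  proof -
    have "2 * i + int m \<in> {i. \<forall>j\<ge>i. of_nat (hilbert_fun (EV m) (gr_E m) j) = poly ?H (of_int j)}"
      using HF[OF A[OF that]] unfolding H by auto
    then have "reg_index (EV m) (gr_E m) \<le> ereal (real_of_int (2 * i + int m))"
      unfolding reg_index_def by (rule INF_lower)
    then show ?thesis by simp
  qed
  have t: "reg_index RV gr = (INF i\<in>A. ereal (real_of_int i))"
    by (simp add: reg_index_def A_def)
  show "reg_index (EV m) (gr_E m) \<le> 2 * reg_index RV gr + ereal (real m)"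
  proof (cases "reg_index RV gr = \<infinity>")
    case True
    then show ?thesis by simp
  next
    case False
    \<comment> \<open>The infimum may be minus infinity, as for an empty set of points. Instead of
      rescaling an infimum of extended reals, an index below a suitable real threshold is
      picked.\<close>
    have less: "\<exists>i\<in>A. ereal (real_of_int i) < y" if "reg_index RV gr < y" for y
      using that unfolding t INF_less_iff .
    show ?thesis
    proof (rule ccontr)
      assume "\<not> ?thesis"
      then have lt: "2 * reg_index RV gr + ereal (real m) < reg_index (EV m) (gr_E m)" by simp
      \<comment> \<open>Some index exists, which bounds the index of the forms from above, while
        \<open>lt\<close> excludes minus infinity; so it is a real number \<open>e\<close>.\<close>
      obtain i where "i \<in> A" using less[of \<infinity>] False by auto
      from bound[OF this] obtain e where e: "reg_index (EV m) (gr_E m) = ereal e"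
        using lt by (cases "reg_index (EV m) (gr_E m)") auto
      \<comment> \<open>The threshold solves \<open>2 * i + m < e\<close> for \<open>i\<close>; an
        index below it contradicts \<open>bound\<close>.\<close>
      have "reg_index RV gr < ereal ((e - real m) / 2)"
        using lt False unfolding e by (cases "reg_index RV gr") auto
      then obtain i where "i \<in> A" "real_of_int i < (e - real m) / 2" using less by fastforce
      then show False using bound[of i] unfolding e by simp
    qed
  qed
qed

end

section \<open>Polynomials\<close>

definition mono_deg :: "(nat \<Rightarrow>\<^sub>0 nat) \<Rightarrow> nat" where
  "mono_deg \<alpha> = (\<Sum>i\<in>Poly_Mapping.keys \<alpha>. Poly_Mapping.lookup \<alpha> i)"

definition mono_eval :: "(nat \<Rightarrow> 'k::field) \<Rightarrow> (nat \<Rightarrow>\<^sub>0 nat) \<Rightarrow> 'k" where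
  "mono_eval v \<alpha> = (\<Prod>i\<in>Poly_Mapping.keys \<alpha>. v i ^ Poly_Mapping.lookup \<alpha> i)"

lemma mono_deg_simps [simp]: "mono_deg 0 = 0" "mono_deg (Poly_Mapping.single k c) = c"
  by (simp_all add: mono_deg_def)

lemma mono_eval_simps [simp]: "mono_eval v 0 = 1" "mono_eval v (Poly_Mapping.single k c) = v k ^ c"
  by (simp_all add: mono_eval_def)

lemma mono_deg_eq_0D:
  assumes "mono_deg \<alpha> = 0"
  shows "\<alpha> = 0"
proof (rule poly_mapping_eqI)
  show "Poly_Mapping.lookup \<alpha> k = Poly_Mapping.lookup 0 k" for k
    using assms by (cases "k \<in> Poly_Mapping.keys \<alpha>") (auto simp: mono_deg_def in_keys_iff)
qed

text \<open>The linear functional with prescribed values \<open>w\<close> on the monomials.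
  Evaluation and the Euler operator are both of this form, which reduces their product rules to
  monomials.\<close>

definition monomial_sum :: "((nat \<Rightarrow>\<^sub>0 nat) \<Rightarrow> 'k::field) \<Rightarrow> 'k mpoly \<Rightarrow> 'k" where
  "monomial_sum w f = (\<Sum>\<alpha>\<in>Poly_Mapping.keys f. Poly_Mapping.lookup f \<alpha> * w \<alpha>)"

text \<open>The value at \<open>v\<close> of the sum of the \<open>X_i\<close> times the partial
  derivatives by \<open>X_i\<close>: that operator multiplies a monomial by its degree.\<close>

definition euler :: "(nat \<Rightarrow> 'k::field) \<Rightarrow> 'k mpoly \<Rightarrow> 'k" where
  "euler v = monomial_sum (\<lambda>\<alpha>. of_nat (mono_deg \<alpha>) * mono_eval v \<alpha>)"

lemma mpoly_eval_monomial_sum: "mpoly_eval v = monomial_sum (mono_eval v)"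
  by (simp add: fun_eq_iff mpoly_eval_def monomial_sum_def mono_eval_def)

lemma keys_add_nat:
  "Poly_Mapping.keys (\<alpha> + \<beta> :: 'a \<Rightarrow>\<^sub>0 nat) = Poly_Mapping.keys \<alpha> \<union> Poly_Mapping.keys \<beta>"
  by (auto simp: in_keys_iff lookup_add)

lemma mono_deg_superset:
  "Poly_Mapping.keys \<alpha> \<subseteq> A \<Longrightarrow> finite A \<Longrightarrow> mono_deg \<alpha> = (\<Sum>i\<in>A. Poly_Mapping.lookup \<alpha> i)"
  unfolding mono_deg_def by (rule sum.mono_neutral_left) (auto simp: in_keys_iff)

lemma mono_eval_superset:
  "Poly_Mapping.keys \<alpha> \<subseteq> A \<Longrightarrow> finite A \<Longrightarrow> mono_eval v \<alpha> = (\<Prod>i\<in>A. v i ^ Poly_Mapping.lookup \<alpha> i)"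
  unfolding mono_eval_def by (rule prod.mono_neutral_left) (auto simp: in_keys_iff)

lemma mono_deg_add: "mono_deg (\<alpha> + \<beta>) = mono_deg \<alpha> + mono_deg \<beta>"
  using mono_deg_superset[of \<alpha> "Poly_Mapping.keys (\<alpha> + \<beta>)"]
    mono_deg_superset[of \<beta> "Poly_Mapping.keys (\<alpha> + \<beta>)"]
  by (simp add: mono_deg_def[of "\<alpha> + \<beta>"] keys_add_nat lookup_add sum.distrib)

lemma mono_eval_add: "mono_eval v (\<alpha> + \<beta>) = mono_eval v \<alpha> * mono_eval v \<beta>"
  using mono_eval_superset[of \<alpha> "Poly_Mapping.keys (\<alpha> + \<beta>)" v]
    mono_eval_superset[of \<beta> "Poly_Mapping.keys (\<alpha> + \<beta>)" v]
  by (simp add: mono_eval_def[of v "\<alpha> + \<beta>"] keys_add_nat lookup_add power_add prod.distrib)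

lemma mono_eval_scale: "mono_eval (\<lambda>i. c * v i) \<alpha> = c ^ mono_deg \<alpha> * mono_eval v \<alpha>"
  by (simp add: mono_deg_def mono_eval_def power_mult_distrib prod.distrib power_sum)

lemma mpoly_sum_single:
  "f = (\<Sum>\<alpha>\<in>Poly_Mapping.keys f. Poly_Mapping.single \<alpha> (Poly_Mapping.lookup f \<alpha>))"
proof (rule poly_mapping_eqI)
  fix \<beta>
  have "(\<Sum>\<alpha>\<in>Poly_Mapping.keys f. Poly_Mapping.lookup (Poly_Mapping.single \<alpha> (Poly_Mapping.lookup f \<alpha>)) \<beta>)
      = (\<Sum>\<alpha>\<in>Poly_Mapping.keys f. if \<alpha> = \<beta> then Poly_Mapping.lookup f \<beta> else 0)"
    by (rule sum.cong) (auto simp: lookup_single when_def)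
  then show "Poly_Mapping.lookup f \<beta> = Poly_Mapping.lookup
      (\<Sum>\<alpha>\<in>Poly_Mapping.keys f. Poly_Mapping.single \<alpha> (Poly_Mapping.lookup f \<alpha>)) \<beta>"
    by (simp add: lookup_sum in_keys_iff)
qed

text \<open>The bound \<open>A\<close> on the exponents stays available for partial sums; with the
  monomials of one degree as \<open>A\<close>, the induction takes place inside a graded
  piece.\<close>

lemma mpoly_keys_induct:
  fixes f :: "'a \<Rightarrow>\<^sub>0 'b::comm_monoid_add"
  assumes f: "Poly_Mapping.keys f \<subseteq> A" and zero: "P 0"
    and single: "\<And>\<alpha> c. \<alpha> \<in> A \<Longrightarrow> P (Poly_Mapping.single \<alpha> c)"
    and add: "\<And>f g. Poly_Mapping.keys f \<subseteq> A \<Longrightarrow> Poly_Mapping.keys g \<subseteq> A \<Longrightarrow> P f \<Longrightarrow> P g \<Longrightarrow> P (f + g)"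
  shows "P f"
proof -
  let ?s = "\<lambda>\<alpha>. Poly_Mapping.single \<alpha> (Poly_Mapping.lookup f \<alpha>)"
  have "P (sum ?s B) \<and> Poly_Mapping.keys (sum ?s B) \<subseteq> A" if "B \<subseteq> Poly_Mapping.keys f" for B
    using finite_subset[OF that finite_keys] that
  proof (induction B rule: finite_induct)
    case empty
    then show ?case using zero by simp
  next
    case (insert \<alpha> B)
    have s: "\<alpha> \<in> A" "Poly_Mapping.keys (?s \<alpha>) \<subseteq> A" using insert.prems f by auto
    have B: "P (sum ?s B)" "Poly_Mapping.keys (sum ?s B) \<subseteq> A" using insert by auto
    have "Poly_Mapping.keys (?s \<alpha> + sum ?s B) \<subseteq> A"
      using keys_add[of "?s \<alpha>" "sum ?s B"] s(2) B(2) by blast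
    then show ?case using add[OF s(2) B(2) single[OF s(1)] B(1)] insert.hyps by simp
  qed
  from this[of "Poly_Mapping.keys f"] show ?thesis
    using mpoly_sum_single[of f] by simp
qed

lemma monomial_sum_superset:
  "Poly_Mapping.keys f \<subseteq> A \<Longrightarrow> finite A \<Longrightarrow>
    monomial_sum w f = (\<Sum>\<alpha>\<in>A. Poly_Mapping.lookup f \<alpha> * w \<alpha>)"
  unfolding monomial_sum_def by (rule sum.mono_neutral_left) (auto simp: in_keys_iff)

lemma monomial_sum_add: "monomial_sum w (f + g) = monomial_sum w f + monomial_sum w g"
proof -
  let ?A = "Poly_Mapping.keys f \<union> Poly_Mapping.keys g"
  have "monomial_sum w (f + g) = (\<Sum>\<alpha>\<in>?A. Poly_Mapping.lookup (f + g) \<alpha> * w \<alpha>)"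
    by (rule monomial_sum_superset) (use keys_add[of f g] in auto)
  also have "\<dots> = (\<Sum>\<alpha>\<in>?A. Poly_Mapping.lookup f \<alpha> * w \<alpha>) + (\<Sum>\<alpha>\<in>?A. Poly_Mapping.lookup g \<alpha> * w \<alpha>)"
    by (simp add: lookup_add distrib_right sum.distrib)
  also have "\<dots> = monomial_sum w f + monomial_sum w g"
    using monomial_sum_superset[of f ?A w] monomial_sum_superset[of g ?A w] by simp
  finally show ?thesis .
qed

lemma monomial_sum_single: "monomial_sum w (Poly_Mapping.single \<alpha> c) = c * w \<alpha>"
  by (simp add: monomial_sum_def)

lemma monomial_sum_zero: "monomial_sum w 0 = 0"
  by (simp add: monomial_sum_def)

lemma mpoly_mult_induct:
  fixes f g :: "'k::field mpoly"
  assumes single: "\<And>\<alpha> \<beta> c d. P (Poly_Mapping.single \<alpha> c) (Poly_Mapping.single \<beta> d)"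
    and zero: "\<And>f. P 0 f" "\<And>f. P f 0"
    and add: "\<And>f g h. P f h \<Longrightarrow> P g h \<Longrightarrow> P (f + g) h" "\<And>f g h. P f g \<Longrightarrow> P f h \<Longrightarrow> P f (g + h)"
  shows "P f g"
proof (rule mpoly_keys_induct[of f UNIV "\<lambda>f. P f g"])
  fix \<alpha> c
  show "P (Poly_Mapping.single \<alpha> c) g"
    by (rule mpoly_keys_induct[of g UNIV]) (auto intro: assms)
qed (auto intro: assms)

lemma mpoly_eval_mult: "mpoly_eval v (f * g) = mpoly_eval v f * mpoly_eval v g"
  unfolding mpoly_eval_monomial_sum
  by (rule mpoly_mult_induct[where P = "\<lambda>f g. monomial_sum (mono_eval v) (f * g) =
        monomial_sum (mono_eval v) f * monomial_sum (mono_eval v) g"])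
    (simp_all only: mult_single monomial_sum_single mono_eval_add monomial_sum_zero
      monomial_sum_add distrib_left distrib_right mult_zero_left mult_zero_right mult_ac)

lemma mpoly_eval_add: "mpoly_eval v (f + g) = mpoly_eval v f + mpoly_eval v g"
  unfolding mpoly_eval_monomial_sum by (rule monomial_sum_add)

lemma euler_add: "euler v (f + g) = euler v f + euler v g"
  unfolding euler_def by (rule monomial_sum_add)

text \<open>On monomials this is additivity of the degree together with multiplicativity of the
  evaluation, and both sides are additive in each factor.\<close>

lemma euler_mult: "euler v (f * g) = mpoly_eval v f * euler v g + mpoly_eval v g * euler v f"
  by (rule mpoly_mult_induct[where P = "\<lambda>f g. euler v (f * g) =
        mpoly_eval v f * euler v g + mpoly_eval v g * euler v f"])
    (simp_all add: mpoly_eval_monomial_sum euler_def mult_single monomial_sum_single mono_eval_add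
      mono_deg_add monomial_sum_zero monomial_sum_add algebra_simps)

lemma mpoly_eval_const: "mpoly_eval v (Poly_Mapping.single 0 c) = c"
  by (simp add: mpoly_eval_monomial_sum monomial_sum_single)

lemma euler_const: "euler v (Poly_Mapping.single 0 c) = 0"
  by (simp add: euler_def monomial_sum_single)

abbreviation mpoly_var :: "nat \<Rightarrow> 'k::field mpoly" where
  "mpoly_var k \<equiv> Poly_Mapping.single (Poly_Mapping.single k 1) 1"

lemma mpoly_eval_var: "mpoly_eval v (mpoly_var k) = v k"
  by (simp add: mpoly_eval_monomial_sum monomial_sum_single)

lemma euler_var: "euler v (mpoly_var k) = v k"
  by (simp add: euler_def monomial_sum_single)

section \<open>The polynomial ring and its grading\<close>

lemma poly_ring_simps [simp]:
  "mult (poly_ring n) = (*)" "add (poly_ring n) = (+)"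
  "\<one>\<^bsub>poly_ring n\<^esub> = 1" "\<zero>\<^bsub>poly_ring n\<^esub> = 0"
  by (simp_all add: poly_ring_def)

lemma poly_ring_carrier:
  "carrier (poly_ring n) = {f. \<forall>\<alpha>\<in>Poly_Mapping.keys f. Poly_Mapping.keys \<alpha> \<subseteq> {..n}}"
  by (simp add: poly_ring_def)

lemma poly_ring_add_closed:
  "f \<in> carrier (poly_ring n) \<Longrightarrow> g \<in> carrier (poly_ring n) \<Longrightarrow> f + g \<in> carrier (poly_ring n)"
  using keys_add[of f g] unfolding poly_ring_carrier by blast

lemma poly_ring_mult_closed:
  "f \<in> carrier (poly_ring n) \<Longrightarrow> g \<in> carrier (poly_ring n) \<Longrightarrow> f * g \<in> carrier (poly_ring n)"
  using keys_mult[of f g] unfolding poly_ring_carrier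
  by (fastforce simp: keys_add_nat)

lemma poly_ring_const_closed: "Poly_Mapping.single 0 c \<in> carrier (poly_ring n)"
  by (simp add: poly_ring_carrier)

lemma poly_ring_uminus_closed:
  fixes f :: "'k::field mpoly"
  assumes "f \<in> carrier (poly_ring n)"
  shows "- f \<in> carrier (poly_ring n)"
proof -
  have "Poly_Mapping.single 0 (- 1) * f = - f"
    by (simp add: single_uminus)
  then show ?thesis
    using poly_ring_mult_closed[OF poly_ring_const_closed assms, of "- 1"] by simp
qed

lemma poly_ring_cring: "cring (poly_ring n :: 'k::field mpoly ring)"
proof (rule cringI)
  let ?S = "poly_ring n :: 'k mpoly ring"
  show "abelian_group ?S"
  proof (rule abelian_groupI)
    show "\<exists>g\<in>carrier ?S. g \<oplus>\<^bsub>?S\<^esub> f = \<zero>\<^bsub>?S\<^esub>" if "f \<in> carrier ?S" for f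
      using poly_ring_uminus_closed[OF that] by (intro bexI[of _ "- f"]) auto
    show "\<zero>\<^bsub>?S\<^esub> \<in> carrier ?S" by (simp add: poly_ring_carrier)
  qed (auto intro: poly_ring_add_closed simp: add_ac)
  show "comm_monoid ?S"
  proof (rule comm_monoidI)
    show "\<one>\<^bsub>?S\<^esub> \<in> carrier ?S" using poly_ring_const_closed[of 1 n] by simp
  qed (auto intro: poly_ring_mult_closed simp: mult_ac)
qed (auto simp: distrib_right)

lemma poly_ring_minus:
  assumes "f \<in> carrier (poly_ring n)" "g \<in> carrier (poly_ring n)"
  shows "f \<ominus>\<^bsub>poly_ring n\<^esub> g = f - (g :: 'k::field mpoly)"
proof -
  interpret cring "poly_ring n :: 'k mpoly ring" by (rule poly_ring_cring)
  have "\<ominus>\<^bsub>poly_ring n\<^esub> g = - g"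
    by (rule minus_equality) (use assms poly_ring_uminus_closed in auto)
  then show ?thesis by (simp add: a_minus_def)
qed

lemma poly_grading_iff:
  "f \<in> poly_grading n i \<longleftrightarrow> (\<forall>\<alpha>\<in>Poly_Mapping.keys f. Poly_Mapping.keys \<alpha> \<subseteq> {..n} \<and> int (mono_deg \<alpha>) = i)"
  by (auto simp: poly_grading_def poly_ring_carrier mono_deg_def)

lemma poly_grading_closed: "f \<in> poly_grading n i \<Longrightarrow> f \<in> carrier (poly_ring n)"
  by (simp add: poly_grading_def)

lemma poly_grading_zero: "0 \<in> poly_grading n i"
  by (simp add: poly_grading_iff)

lemma poly_grading_add: "f \<in> poly_grading n i \<Longrightarrow> g \<in> poly_grading n i \<Longrightarrow> f + g \<in> poly_grading n i"
  using keys_add[of f g] unfolding poly_grading_iff by blast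

lemma poly_grading_mult:
  assumes "f \<in> poly_grading n i" "g \<in> poly_grading n j"
  shows "f * g \<in> poly_grading n (i + j)"
  unfolding poly_grading_iff
proof
  fix \<gamma> assume "\<gamma> \<in> Poly_Mapping.keys (f * g)"
  then obtain \<alpha> \<beta> where ab: "\<alpha> \<in> Poly_Mapping.keys f" "\<beta> \<in> Poly_Mapping.keys g" "\<gamma> = \<alpha> + \<beta>"
    using keys_mult[of f g] by blast
  have "int (mono_deg \<gamma>) = int (mono_deg \<alpha>) + int (mono_deg \<beta>)"
    unfolding ab(3) mono_deg_add by (rule of_nat_add)
  moreover have "Poly_Mapping.keys \<gamma> = Poly_Mapping.keys \<alpha> \<union> Poly_Mapping.keys \<beta>"
    unfolding ab(3) by (rule keys_add_nat)
  ultimately show "Poly_Mapping.keys \<gamma> \<subseteq> {..n} \<and> int (mono_deg \<gamma>) = i + j"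
    using assms ab(1,2) unfolding poly_grading_iff by auto
qed

lemma poly_grading_const: "Poly_Mapping.single 0 c \<in> poly_grading n 0"
  by (simp add: poly_grading_iff)

lemma poly_grading_var: "k \<le> n \<Longrightarrow> mpoly_var k \<in> poly_grading n 1"
  by (simp add: poly_grading_iff)

lemma poly_grading_neg: "i < 0 \<Longrightarrow> f \<in> poly_grading n i \<Longrightarrow> f = 0"
proof -
  assume "i < 0" "f \<in> poly_grading n i"
  then have "Poly_Mapping.keys f = {}" by (auto simp: poly_grading_iff)
  then show "f = 0" by (metis mpoly_sum_single sum.empty)
qed

lemma poly_grading_0:
  assumes "f \<in> poly_grading n 0"
  shows "\<exists>c. f = Poly_Mapping.single 0 c"
proof (rule mpoly_keys_induct[of f "{0}"])
  have "\<alpha> = 0" if "\<alpha> \<in> Poly_Mapping.keys f" for \<alpha>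
    using assms that by (intro mono_deg_eq_0D) (auto simp: poly_grading_iff)
  then show "Poly_Mapping.keys f \<subseteq> {0}" by auto
  show "\<exists>c. (0 :: 'a mpoly) = Poly_Mapping.single 0 c" by (intro exI[of _ 0]) simp
  show "\<exists>c. f + g = Poly_Mapping.single 0 c"
    if "\<exists>c. f = Poly_Mapping.single 0 c" "\<exists>c. g = Poly_Mapping.single 0 c" for f g :: "'a mpoly"
    using that by (metis single_add)
qed auto

text \<open>A monomial of positive degree is divisible by one of its variables; in degree zero there
  is no such factor, hence \<open>i > 0\<close>.\<close>

lemma poly_grading_induct:
  fixes f :: "'k::field mpoly"
  assumes "i > 0" and f: "f \<in> poly_grading n i" and zero: "P 0"
    and add: "\<And>f g. f \<in> poly_grading n i \<Longrightarrow> g \<in> poly_grading n i \<Longrightarrow> P f \<Longrightarrow> P g \<Longrightarrow> P (f + g)"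
    and var: "\<And>k g. k \<le> n \<Longrightarrow> g \<in> poly_grading n (i - 1) \<Longrightarrow> P (mpoly_var k * g)"
  shows "P f"
proof (rule mpoly_keys_induct[of f "{\<alpha>. Poly_Mapping.keys \<alpha> \<subseteq> {..n} \<and> int (mono_deg \<alpha>) = i}"])
  fix \<alpha> and c :: 'k
  assume "\<alpha> \<in> {\<alpha>. Poly_Mapping.keys \<alpha> \<subseteq> {..n} \<and> int (mono_deg \<alpha>) = i}"
  then have \<alpha>: "Poly_Mapping.keys \<alpha> \<subseteq> {..n}" "int (mono_deg \<alpha>) = i" by auto
  have "Poly_Mapping.keys \<alpha> \<noteq> {}" using \<alpha>(2) \<open>i > 0\<close> by (auto simp: mono_deg_def)
  then obtain k where k: "k \<in> Poly_Mapping.keys \<alpha>" by blast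
  \<comment> \<open>Exponents are subtracted with truncation; as \<open>k\<close> occurs in
    \<open>\<alpha>\<close>, nothing is lost.\<close>
  define \<beta> where "\<beta> = \<alpha> - Poly_Mapping.single k 1"
  have ab: "\<alpha> = Poly_Mapping.single k 1 + \<beta>"
    by (rule poly_mapping_eqI)
      (use k in \<open>auto simp: \<beta>_def lookup_add lookup_minus lookup_single when_def in_keys_iff\<close>)
  have "mono_deg \<alpha> = mono_deg (Poly_Mapping.single k 1) + mono_deg \<beta>"
    unfolding ab by (rule mono_deg_add)
  then have "int (mono_deg \<beta>) = i - 1" using \<alpha>(2) by simp
  moreover have "Poly_Mapping.keys \<beta> \<subseteq> {..n}" using \<alpha>(1) unfolding ab keys_add_nat by auto
  ultimately have "Poly_Mapping.single \<beta> c \<in> poly_grading n (i - 1)" by (simp add: poly_grading_iff)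
  from var[OF _ this, of k] show "P (Poly_Mapping.single \<alpha> c)"
    using k \<alpha>(1) by (auto simp: mult_single ab[symmetric] simp del: One_nat_def)
next
  show "P (g + h)" if "P g" "P h"
    "Poly_Mapping.keys g \<subseteq> {\<alpha>. Poly_Mapping.keys \<alpha> \<subseteq> {..n} \<and> int (mono_deg \<alpha>) = i}"
    "Poly_Mapping.keys h \<subseteq> {\<alpha>. Poly_Mapping.keys \<alpha> \<subseteq> {..n} \<and> int (mono_deg \<alpha>) = i}" for g h
    by (rule add) (use that in \<open>auto simp: poly_grading_iff\<close>)
qed (use f zero in \<open>auto simp: poly_grading_iff\<close>)

text \<open>This makes the vanishing of a form at a projective point independent of the coordinate
  vector.\<close>

lemma mpoly_eval_scale:
  assumes "f \<in> poly_grading n (int e)"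
  shows "mpoly_eval (\<lambda>i. c * v i) f = c ^ e * mpoly_eval v f"
  unfolding mpoly_eval_monomial_sum monomial_sum_def sum_distrib_left
proof (rule sum.cong)
  fix \<alpha> assume "\<alpha> \<in> Poly_Mapping.keys f"
  then have "mono_deg \<alpha> = e" using assms by (auto simp: poly_grading_iff)
  then show "Poly_Mapping.lookup f \<alpha> * mono_eval (\<lambda>i. c * v i) \<alpha> =
      c ^ e * (Poly_Mapping.lookup f \<alpha> * mono_eval v \<alpha>)"
    unfolding mono_eval_scale by simp
qed simp

lemma euler_homogeneous:
  assumes "f \<in> poly_grading n i"
  shows "euler v f = of_int i * mpoly_eval v f"
  unfolding euler_def mpoly_eval_monomial_sum monomial_sum_def sum_distrib_left
proof (rule sum.cong)
  fix \<alpha> assume "\<alpha> \<in> Poly_Mapping.keys f"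
  then have "i = int (mono_deg \<alpha>)" using assms by (auto simp: poly_grading_iff)
  then have "of_int i = (of_nat (mono_deg \<alpha>) :: 'a)" by (simp only: of_int_of_nat_eq)
  then show "Poly_Mapping.lookup f \<alpha> * (of_nat (mono_deg \<alpha>) * mono_eval v \<alpha>) =
      of_int i * (Poly_Mapping.lookup f \<alpha> * mono_eval v \<alpha>)"
    by (simp only: mult_ac)
qed simp


section \<open>The coordinate ring of a set of points\<close>

locale point_set =
  fixes n :: nat and X :: "(nat \<Rightarrow> 'k::field) set set"
  assumes proj: "X \<subseteq> proj_space n" and finite_X: "finite X"
    and nonzero: "\<And>P v. P \<in> X \<Longrightarrow> v \<in> P \<Longrightarrow> v 0 \<noteq> 0"
begin

text \<open>Dividing by the nonzero coordinate 0 gives exactly one such vector in each point of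
  \<open>X\<close>.\<close>

definition rep :: "(nat \<Rightarrow> 'k) set \<Rightarrow> nat \<Rightarrow> 'k" where
  "rep P = (SOME v. v \<in> P \<and> v 0 = 1)"

lemma rep_props:
  assumes P: "P \<in> X"
  shows "rep P 0 = 1" and "i > n \<Longrightarrow> rep P i = 0" and "P = {(\<lambda>i. c * rep P i) | c. c \<noteq> 0}"
    and "rep P \<in> P"
proof -
  have "P \<in> proj_space n" using P proj by blast
  then obtain w where w: "\<forall>i>n. w i = 0" "P = {u. \<exists>c. c \<noteq> 0 \<and> u = (\<lambda>i. c * w i)}"
    by (auto simp: proj_space_def quotient_def)
  have "w \<in> P" unfolding w(2) by (auto intro: exI[of _ 1])
  then have w0: "w 0 \<noteq> 0" using nonzero[OF P] by blast
  have "(\<lambda>i. inverse (w 0) * w i) \<in> P"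
    unfolding w(2) using w0 by (intro CollectI exI[of _ "inverse (w 0)"]) auto
  then have "\<exists>v. v \<in> P \<and> v 0 = 1" using w0 by (intro exI[of _ "\<lambda>i. inverse (w 0) * w i"]) auto
  then have rep: "rep P \<in> P \<and> rep P 0 = 1" unfolding rep_def by (rule someI_ex)
  then obtain c where c: "c \<noteq> 0" "rep P = (\<lambda>i. c * w i)" using w(2) by blast
  show "rep P 0 = 1" "rep P \<in> P" using rep by blast+
  show "rep P i = 0" if "i > n" using that w(1) c(2) by simp
  show "P = {(\<lambda>i. c * rep P i) | c. c \<noteq> 0}"
  proof (intro subset_antisym subsetI)
    fix u assume "u \<in> P"
    then obtain e where e: "e \<noteq> 0" "u = (\<lambda>i. e * w i)" using w(2) by blast
    then have "e / c \<noteq> 0" "u = (\<lambda>i. e / c * rep P i)" using c by auto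
    then show "u \<in> {(\<lambda>i. c * rep P i) | c. c \<noteq> 0}" by blast
  next
    fix u assume "u \<in> {(\<lambda>i. c * rep P i) | c. c \<noteq> 0}"
    then obtain e where e: "e \<noteq> 0" "u = (\<lambda>i. e * rep P i)" by blast
    then have "e * c \<noteq> 0" "u = (\<lambda>i. e * c * w i)" using c by (auto simp: mult.assoc)
    then show "u \<in> P" unfolding w(2) by blast
  qed
qed

lemma rep_inj:
  assumes "P \<in> X" "Q \<in> X" "P \<noteq> Q"
  shows "\<exists>k\<le>n. rep P k \<noteq> rep Q k"
proof (rule ccontr)
  assume "\<not> ?thesis"
  then have "rep P k = rep Q k" for k
    using rep_props(2)[OF assms(1), of k] rep_props(2)[OF assms(2), of k] by (cases "k \<le> n") auto
  then have "rep P = rep Q" by blast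
  then show False using rep_props(3)[OF assms(1)] rep_props(3)[OF assms(2)] assms(3) by simp
qed

section \<open>The vanishing ideal and the residue class ring\<close>

abbreviation S where "S \<equiv> poly_ring n :: 'k mpoly ring"
abbreviation I where "I \<equiv> vanishing_ideal n X"
abbreviation R where "R \<equiv> coord_ring n X"
abbreviation \<pi> where "\<pi> \<equiv> coord_class n X"

interpretation S: cring S by (rule poly_ring_cring)

definition gens where
  "gens = {f. (\<exists>d. f \<in> poly_grading n d) \<and> (\<forall>P\<in>X. \<forall>v\<in>P. mpoly_eval v f = 0)}"

lemma vanishing_ideal_gens: "I = Idl\<^bsub>S\<^esub> gens"
  by (simp add: vanishing_ideal_def gens_def)

lemma gens_closed: "gens \<subseteq> carrier S"
  using poly_grading_closed by (auto simp: gens_def)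

lemma I_ideal: "ideal I S"
  unfolding vanishing_ideal_gens by (rule S.genideal_ideal[OF gens_closed])

text \<open>The polynomials on which evaluation and Euler operator at \<open>P\<close> both vanish
  form an ideal: by the Leibniz rule the derivative of a multiple vanishes only together with the
  value. The homogeneous generators lie in it by Euler's identity.\<close>

lemma I_vanishes:
  assumes f: "f \<in> I" and P: "P \<in> X"
  shows "mpoly_eval (rep P) f = 0" and "euler (rep P) f = 0"
proof -
  let ?K = "{f \<in> carrier S. mpoly_eval (rep P) f = 0 \<and> euler (rep P) f = 0}"
  have uminus: "- f \<in> ?K" if "f \<in> ?K" for f
  proof -
    have "mpoly_eval (rep P) (- f) + mpoly_eval (rep P) f = 0"
      "euler (rep P) (- f) + euler (rep P) f = 0"
      unfolding mpoly_eval_add[symmetric] euler_add[symmetric]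
      by (simp_all add: mpoly_eval_monomial_sum euler_def monomial_sum_zero)
    then show ?thesis using that poly_ring_uminus_closed by auto
  qed
  have zero: "0 \<in> ?K"
    using poly_grading_closed[OF poly_grading_zero, of n]
    by (auto simp: mpoly_eval_monomial_sum euler_def monomial_sum_zero)
  have "ideal ?K S"
  proof (rule idealI[OF S.ring_axioms])
    show "subgroup ?K (add_monoid S)"
    proof (rule S.add.subgroupI)
      fix f assume f: "f \<in> ?K"
      have "\<ominus>\<^bsub>S\<^esub> f = - f"
        by (rule S.minus_equality) (use f poly_ring_uminus_closed in auto)
      then show "\<ominus>\<^bsub>S\<^esub> f \<in> ?K" using uminus[OF f] by simp
    next
      show "?K \<noteq> {}" using zero by blast
    next
      show "f \<oplus>\<^bsub>S\<^esub> g \<in> ?K" if "f \<in> ?K" "g \<in> ?K" for f g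
        using that poly_ring_add_closed[of f n g] by (simp add: mpoly_eval_add euler_add)
    qed auto
  qed (auto simp: poly_ring_mult_closed mpoly_eval_mult euler_mult)
  moreover have "gens \<subseteq> ?K"
  proof
    fix f assume f: "f \<in> gens"
    then obtain d where d: "f \<in> poly_grading n d" by (auto simp: gens_def)
    have "mpoly_eval (rep P) f = 0" using f P rep_props(4)[OF P] unfolding gens_def by blast
    then show "f \<in> ?K" using euler_homogeneous[OF d] poly_grading_closed[OF d] by simp
  qed
  ultimately have "I \<subseteq> ?K" unfolding vanishing_ideal_gens by (rule S.genideal_minimal)
  then show "mpoly_eval (rep P) f = 0" "euler (rep P) f = 0" using f by auto
qed

text \<open>Vanishing at the chosen representatives spreads to all coordinate vectors by
  homogeneity, which makes \<open>f\<close> one of the generators.\<close>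

lemma homogeneous_in_I:
  assumes f: "f \<in> poly_grading n i" and ev: "\<And>P. P \<in> X \<Longrightarrow> mpoly_eval (rep P) f = 0"
  shows "f \<in> I"
proof -
  have "f \<in> gens" unfolding gens_def
  proof (intro CollectI conjI ballI)
    fix P v assume P: "P \<in> X" and "v \<in> P"
    then obtain c where c: "v = (\<lambda>i. c * rep P i)" using rep_props(3)[OF P] by blast
    show "mpoly_eval v f = 0"
    \<comment> \<open>The scaling rule has a natural exponent; in negative degree \<open>f\<close>
      is zero anyway.\<close>
    proof (cases "i < 0")
      case True
      then show ?thesis
        using poly_grading_neg[OF True f] by (simp add: mpoly_eval_monomial_sum monomial_sum_zero)
    next
      case False
      then obtain e where "i = int e" by (metis nonneg_int_cases not_less)
      then have "f \<in> poly_grading n (int e)" using f by simp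
      then show ?thesis unfolding c by (simp only: mpoly_eval_scale ev[OF P] mult_zero_right)
    qed
  qed (use f in blast)
  then show ?thesis unfolding vanishing_ideal_gens using S.genideal_self[OF gens_closed] by blast
qed

interpretation I: ideal I S by (rule I_ideal)

interpretation I: abelian_subgroup I S
  by (rule abelian_subgroupI3[OF I.additive_subgroup_axioms S.abelian_group_axioms])

lemma R_cring: "cring R"
  unfolding coord_ring_def by (rule I.quotient_is_cring[OF S.is_cring])

lemma class_hom: "\<pi> \<in> Ring.ring_hom S R"
proof -
  have "\<pi> = (+>\<^bsub>S\<^esub>) I" by (simp add: fun_eq_iff coord_class_def)
  then show ?thesis unfolding coord_ring_def using I.rcos_ring_hom by simp
qed

lemma class_closed: "f \<in> carrier S \<Longrightarrow> \<pi> f \<in> carrier R"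
  by (rule ring_hom_closed[OF class_hom])

lemma class_add: "f \<in> carrier S \<Longrightarrow> g \<in> carrier S \<Longrightarrow> \<pi> f \<oplus>\<^bsub>R\<^esub> \<pi> g = \<pi> (f + g)"
  using ring_hom_add[OF class_hom, of f g] by simp

lemma class_mult: "f \<in> carrier S \<Longrightarrow> g \<in> carrier S \<Longrightarrow> \<pi> f \<otimes>\<^bsub>R\<^esub> \<pi> g = \<pi> (f * g)"
  using ring_hom_mult[OF class_hom, of f g] by simp

lemma class_one: "\<pi> 1 = \<one>\<^bsub>R\<^esub>"
  using ring_hom_one[OF class_hom] by simp

lemma class_eqI:
  assumes "f \<in> carrier S" "f \<in> I"
  shows "\<pi> f = \<zero>\<^bsub>R\<^esub>"
  using I.a_rcos_const[OF assms(2)] by (simp add: coord_class_def coord_ring_def FactRing_def)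

lemma class_zero: "\<pi> 0 = \<zero>\<^bsub>R\<^esub>"
  using class_eqI[of 0] I.zero_closed S.zero_closed by simp

lemma R_cases:
  assumes "C \<in> carrier R"
  obtains f where "f \<in> carrier S" "C = \<pi> f"
  using assms by (auto simp: coord_ring_def FactRing_def A_RCOSETS_def' coord_class_def)

definition lift :: "('k mpoly \<Rightarrow> 'k) \<Rightarrow> 'k mpoly set \<Rightarrow> 'k" where
  "lift T C = T (SOME f. f \<in> carrier S \<and> \<pi> f = C)"

text \<open>Representatives of one class differ by an element of the ideal, where \<open>T\<close>
  vanishes, so the choice in \<open>lift\<close> does not matter.\<close>

lemma lift_class:
  assumes add: "\<And>f g. T (f + g) = T f + T g" and zero: "\<And>f. f \<in> I \<Longrightarrow> T f = 0"
    and f: "f \<in> carrier S"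
  shows "lift T (\<pi> f) = T f"
proof -
  define g where "g = (SOME g. g \<in> carrier S \<and> \<pi> g = \<pi> f)"
  have g: "g \<in> carrier S \<and> \<pi> g = \<pi> f"
    unfolding g_def by (rule someI_ex) (use f in blast)
  have "g \<in> I +>\<^bsub>S\<^esub> f"
    using I.a_rcos_self[of g] g by (simp add: coord_class_def)
  then have "g \<ominus>\<^bsub>S\<^esub> f \<in> I"
    using I.a_rcos_module[OF f, of g] g by (simp add: a_minus_def)
  then have "g - f \<in> I" using poly_ring_minus[of g n f] g f by simp
  then have "T (g - f + f) = T f" unfolding add using zero by simp
  then show ?thesis by (simp add: lift_def g_def)
qed

definition pt_ev where "pt_ev P = lift (mpoly_eval (rep P))"
definition pt_D where "pt_D P = lift (euler (rep P))"

lemma pt_ev_class: "P \<in> X \<Longrightarrow> f \<in> carrier S \<Longrightarrow> pt_ev P (\<pi> f) = mpoly_eval (rep P) f"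
  unfolding pt_ev_def by (rule lift_class) (auto simp: mpoly_eval_add I_vanishes)

lemma pt_D_class: "P \<in> X \<Longrightarrow> f \<in> carrier S \<Longrightarrow> pt_D P (\<pi> f) = euler (rep P) f"
  unfolding pt_D_def by (rule lift_class) (auto simp: euler_add I_vanishes)

abbreviation xs where "xs k \<equiv> \<pi> (mpoly_var k)"

lemma grading_cases:
  assumes "C \<in> coord_grading n X i"
  obtains f where "f \<in> poly_grading n i" "f \<in> carrier S" "C = \<pi> f"
  using assms poly_grading_closed by (auto simp: coord_grading_def)

lemma grading_class: "f \<in> poly_grading n i \<Longrightarrow> \<pi> f \<in> coord_grading n X i"
  by (simp add: coord_grading_def)

lemma const_hom: "coord_const n X \<in> Ring.ring_hom class_ring R"
proof (rule ring_hom_memI)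
  show "coord_const n X a \<in> carrier R" for a
    unfolding coord_const_def by (rule class_closed[OF poly_ring_const_closed])
  show "coord_const n X (a \<otimes>\<^bsub>class_ring\<^esub> b) = coord_const n X a \<otimes>\<^bsub>R\<^esub> coord_const n X b" for a b
    by (simp add: coord_const_def class_mult[OF poly_ring_const_closed poly_ring_const_closed] mult_single)
  show "coord_const n X (a \<oplus>\<^bsub>class_ring\<^esub> b) = coord_const n X a \<oplus>\<^bsub>R\<^esub> coord_const n X b" for a b
    by (simp add: coord_const_def class_add[OF poly_ring_const_closed poly_ring_const_closed] single_add)
  show "coord_const n X \<one>\<^bsub>class_ring\<^esub> = \<one>\<^bsub>R\<^esub>"
    by (simp add: coord_const_def class_one)
qed

text \<open>The points index themselves: \<open>J\<close> is \<open>X\<close>. Normalised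
  representatives give \<open>xs 0\<close> the value 1 under both evaluation and Euler map;
  separation by values rests on \<open>homogeneous_in_I\<close>, and the induction rule is
  \<open>poly_grading_induct\<close> carried over to residue classes.\<close>

lemma coord_points_algebra:
  "points_algebra R (coord_const n X) (coord_grading n X) xs n X pt_ev pt_D"
proof (rule points_algebra.intro)
  show "field_algebra R (coord_const n X)"
    by (intro field_algebra.intro field_algebra_axioms.intro R_cring const_hom)
  show "points_algebra_axioms R (coord_const n X) (coord_grading n X) xs n X pt_ev pt_D"
  proof (rule points_algebra_axioms.intro)
    show "a \<in> carrier R" if "a \<in> coord_grading n X i" for a i
      using that class_closed by (elim grading_cases) simp
    show "\<zero>\<^bsub>R\<^esub> \<in> coord_grading n X i" for i
      using grading_class[OF poly_grading_zero] class_zero by metis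
    show "a \<oplus>\<^bsub>R\<^esub> b \<in> coord_grading n X i"
      if "a \<in> coord_grading n X i" "b \<in> coord_grading n X i" for a b i
      using that by (elim grading_cases) (simp add: class_add grading_class poly_grading_add)
    show "a \<otimes>\<^bsub>R\<^esub> b \<in> coord_grading n X (i + j)"
      if "a \<in> coord_grading n X i" "b \<in> coord_grading n X j" for a b i j
      using that by (elim grading_cases) (simp add: class_mult grading_class poly_grading_mult)
    show "coord_const n X c \<in> coord_grading n X 0" for c
      unfolding coord_const_def by (rule grading_class[OF poly_grading_const])
    show "a = \<zero>\<^bsub>R\<^esub>" if i: "i < 0" and a: "a \<in> coord_grading n X i" for a i
    proof -
      obtain f where "f \<in> poly_grading n i" "a = \<pi> f" using a by (rule grading_cases)
      then show ?thesis using poly_grading_neg[OF i] class_zero by metis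
    qed
    show "\<exists>c. a = coord_const n X c" if a: "a \<in> coord_grading n X 0" for a
    proof -
      obtain f where "f \<in> poly_grading n 0" "a = \<pi> f" using a by (rule grading_cases)
      then show ?thesis using poly_grading_0 unfolding coord_const_def by blast
    qed
    show "P a"
      if i: "0 < i" and a: "a \<in> coord_grading n X i" and zero: "P \<zero>\<^bsub>R\<^esub>"
        and add: "\<And>b c. b \<in> coord_grading n X i \<Longrightarrow> c \<in> coord_grading n X i \<Longrightarrow>
          P b \<Longrightarrow> P c \<Longrightarrow> P (b \<oplus>\<^bsub>R\<^esub> c)"
        and var: "\<And>k b. k \<le> n \<Longrightarrow> b \<in> coord_grading n X (i - 1) \<Longrightarrow> P (xs k \<otimes>\<^bsub>R\<^esub> b)"
      for i a P
    proof -
      obtain f where f: "f \<in> poly_grading n i" "a = \<pi> f" using a by (rule grading_cases)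
      have "P (\<pi> f)"
      proof (rule poly_grading_induct[OF i f(1), of "\<lambda>f. P (\<pi> f)"])
        show "P (\<pi> 0)" using zero class_zero by simp
        show "P (\<pi> (g + h))"
          if "g \<in> poly_grading n i" "h \<in> poly_grading n i" "P (\<pi> g)" "P (\<pi> h)" for g h
          using add[OF grading_class[OF that(1)] grading_class[OF that(2)] that(3,4)]
            class_add[OF poly_grading_closed[OF that(1)] poly_grading_closed[OF that(2)]] by simp
        show "P (\<pi> (mpoly_var k * g))" if "k \<le> n" "g \<in> poly_grading n (i - 1)" for k g
          using var[OF that(1) grading_class[OF that(2)]]
            class_mult[OF poly_grading_closed[OF poly_grading_var[OF that(1)]]
              poly_grading_closed[OF that(2)]] by simp
      qed
      then show ?thesis using f(2) by simp
    qed
    show "xs k \<in> coord_grading n X 1" if "k \<le> n" for k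
      by (rule grading_class[OF poly_grading_var[OF that]])
    show "finite X" by (rule finite_X)
    show "pt_ev P \<in> Ring.ring_hom R class_ring" if P: "P \<in> X" for P
    proof (rule ring_hom_memI)
      show "pt_ev P (a \<otimes>\<^bsub>R\<^esub> b) = pt_ev P a \<otimes>\<^bsub>class_ring\<^esub> pt_ev P b"
        if "a \<in> carrier R" "b \<in> carrier R" for a b
        using that by (elim R_cases)
          (simp add: class_mult pt_ev_class[OF P] poly_ring_mult_closed mpoly_eval_mult)
      show "pt_ev P (a \<oplus>\<^bsub>R\<^esub> b) = pt_ev P a \<oplus>\<^bsub>class_ring\<^esub> pt_ev P b"
        if "a \<in> carrier R" "b \<in> carrier R" for a b
        using that by (elim R_cases)
          (simp add: class_add pt_ev_class[OF P] poly_ring_add_closed mpoly_eval_add)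
      have "pt_ev P (\<pi> 1) = 1"
        using pt_ev_class[OF P poly_ring_const_closed[of 1]] mpoly_eval_const[of "rep P" 1] by simp
      then show "pt_ev P \<one>\<^bsub>R\<^esub> = \<one>\<^bsub>class_ring\<^esub>" by (simp add: class_one)
    qed simp
    show "pt_ev P (coord_const n X c) = c" if "P \<in> X" for P c
      unfolding coord_const_def pt_ev_class[OF that poly_ring_const_closed] by (rule mpoly_eval_const)
    have var: "mpoly_var k \<in> carrier S" if "k \<le> n" for k
      by (rule poly_grading_closed[OF poly_grading_var[OF that]])
    show "pt_ev P (xs 0) = 1" if "P \<in> X" for P
      using pt_ev_class[OF that var[of 0]] mpoly_eval_var[of "rep P" 0] rep_props(1)[OF that] by simp
    show "a = \<zero>\<^bsub>R\<^esub>" if a: "a \<in> coord_grading n X i" and ev: "\<And>P. P \<in> X \<Longrightarrow> pt_ev P a = 0" for a i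
    proof -
      obtain f where f: "f \<in> poly_grading n i" "f \<in> carrier S" "a = \<pi> f" using a by (rule grading_cases)
      have "f \<in> I"
        by (rule homogeneous_in_I[OF f(1)]) (use ev pt_ev_class f(2,3) in fastforce)
      then show ?thesis unfolding f(3) by (rule class_eqI[OF f(2)])
    qed
    show "\<exists>k\<le>n. pt_ev P (xs k) \<noteq> pt_ev Q (xs k)" if PQ: "P \<in> X" "Q \<in> X" "P \<noteq> Q" for P Q
    proof -
      obtain k where "k \<le> n" "rep P k \<noteq> rep Q k" using rep_inj[OF PQ] by blast
      then show ?thesis
        using pt_ev_class[OF PQ(1) var[of k]] pt_ev_class[OF PQ(2) var[of k]]
          mpoly_eval_var[of "rep P" k] mpoly_eval_var[of "rep Q" k] by metis
    qed
    show "pt_D P (a \<oplus>\<^bsub>R\<^esub> b) = pt_D P a + pt_D P b"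
      if "P \<in> X" "a \<in> carrier R" "b \<in> carrier R" for P a b
      using that by (elim R_cases) (simp add: class_add pt_D_class poly_ring_add_closed euler_add)
    show "pt_D P (a \<otimes>\<^bsub>R\<^esub> b) = pt_ev P a * pt_D P b + pt_ev P b * pt_D P a"
      if "P \<in> X" "a \<in> carrier R" "b \<in> carrier R" for P a b
      using that by (elim R_cases)
        (simp add: class_mult pt_D_class pt_ev_class poly_ring_mult_closed euler_mult)
    show "pt_D P (coord_const n X c) = 0" if "P \<in> X" for P c
      unfolding coord_const_def pt_D_class[OF that poly_ring_const_closed] by (rule euler_const)
    show "pt_D P (xs 0) = 1" if "P \<in> X" for P
      using pt_D_class[OF that var[of 0]] euler_var[of "rep P" 0] rep_props(1)[OF that] by simp
  qed
qed

end

theorem proposition7p1: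
  fixes n m s :: nat
    and X :: "(nat \<Rightarrow> 'k::field_char_0) set set"
  assumes "1 \<le> n"
    and "X \<subseteq> proj_space n" and "finite X" and "card X = s"
    and "\<forall>P\<in>X. \<forall>v\<in>P. v 0 \<noteq> 0"
    and "1 \<le> m" and "m \<le> n + 1"
  shows "hilbert_poly (diff_forms_vs n X m) (diff_forms_grading n X m) =
           (if m = 1 then [:of_nat s:] else 0) \<and>
         reg_index (diff_forms_vs n X m) (diff_forms_grading n X m) \<le>
           2 * reg_index (coord_vs n X) (coord_grading n X) + ereal (real m)"
proof -
  interpret point_set n X
    by (rule point_set.intro) (use assms in auto)
  \<comment> \<open>What remains is unfolding: the concrete spaces and gradings are the abstract
    ones of this instance.\<close>
  note result = points_algebra.hilbert_poly_and_reg_index_forms[OF coord_points_algebra \<open>1 \<le> m\<close>]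
  show ?thesis
    using result \<open>card X = s\<close>
    unfolding diff_forms_vs_def diff_forms_def diff_forms_grading_def coord_vs_def by simp
qed

end
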